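(* Let $\mathcal M$ be an $(\varepsilon,\delta)$-differentially private algorithm for training a predictive model on a dataset (for example DP-SGD). The $(\varepsilon,\delta)$-DP Machine Learning controller, which collects users' data during a collection period, at the end of the period trains the model $\mathcal M(\mathcal D)$ on the resulting dataset $\mathcal D$ and publishes it, deletes the dataset after training, and ignores deletion requests from then on (the published model is never changed), satisfies $(\varepsilon,\delta)$-deletion-as-control.
   Context: **Indistinguishability and DP.** Two distributions $P,Q$ on the same measurable space satisfy $P\approx_{\varepsilon,\delta}Q$ if for every event $A$: $P(A)\le e^{\varepsilon}Q(A)+\delta$ and $Q(A)\le e^{\varepsilon}P(A)+\delta$; for random variables it refers to their laws. A dataset $x=(x_1,\dots,x_n)\in\mathcal X^n$ is a vector of elements of a universe $\mathcal X$; two datasets are neighbors if they differ in at most one coordinate. A randomized algorithm $\mathcal M$ is $(\varepsilon,\delta)$-differentially private if $\mathcal M(x)\approx_{\varepsilon,\delta}\mathcal M(x')$ for every pair of neighboring datasets $x,x'$. Random tapes are elements of $\{0,1\}^{\mathbb N}$ with the $\sigma$-algebra generated by the cylinder sets; $\mathcal U$ is the uniform distribution on it. **The controller.** It initializes an empty strongly history independent dictionary $\mathcal D$ and $\mathrm{out}=\bot$ (a value never returned by $\mathcal M$). Here a dictionary is a key-value store with operations insert, delete, get, set, and it is strongly history independent if, from every initial physical state, any two operation sequences leading to the same logical contents produce identically distributed physical memory states (e.g. a sorted list). On an operation $\mathrm{op}(id)$ ($id$ = channel ID): before the $\mathsf{tick}$ (the end of the collection period), it applies $\mathrm{op}(id)$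 to $\mathcal D$ (insert/modify/delete the item with key $id$) and returns $\bot$; at the $\mathsf{tick}$, it sets $\mathrm{out}\gets\mathcal M(\mathcal D)$, erases $\mathcal D$ and returns out; for all future queries it simply returns out. $\mathcal M$ is a function only of the logical contents of $\mathcal D$, independent of its memory representation. The special query $\mathsf{tick}$ can be sent to the controller only by the environment $E$, never by the data subject $Y$. **Execution model.** Parties are (possibly randomized) interactive Turing machines, each with a work tape (its content is the party's state), an input tape, an output tape, an infinite random tape that can be read only once (bits to be reused must be copied to the work tape), and a read-once tape listing the IDs of its channels. Each activation of a party terminates. At most one party is active at a time. Messages are pairs $(\mathrm{cid},\mathrm{msg})$, including the special message $\mathsf{delete}$, sent over authenticated channels; each channel ID cid is associated with two parties. Sending a message deactivates the sender and activates the receiver, who learns cid but not which party is at the other end. Sending on an invalid cid reactivates the sender with input $\mathsf{fail}$. If a party halts without sending, the environment (real execution) or the dummy (ideal execution) is activated. *Real execution* $\langle C(R_C),E,Y\rangle$: a controller $C$ with random tape $R_C$, an environment $E$, a data subject $Y$. $E$ has infinitely many channels to $C$ and one to $Y$; $Y$ has one channel to $C$ and one to $E$; $C$ cannot distinguish its channel with $Y$ from those with $E$. $E$ is activated first. The execution ends when $C$ finishes the activation caused by the first $\mathsf{delete}$ message from $Y$ to $C$. The transcript $\tau$ is the sequence of all messages sent to or by $C$; $\vec q_E$ is the subsequence of messages from $E$ to $C$; $\mathsf{state}_C$ is $C$'s final work tape. If the execution never ends, $\mathsf{state}_C=\bot$ and $\tau,\vec q_E$ are empty. *Ideal execution* $\langle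 C(R'_C),D(\vec q_E)\rangle$: the same $C$ with random tape $R'_C$, and a dummy $D$ that at each activation sends to $C$ the next query of $\vec q_E$ on the same cid, regardless of $C$'s answers (it sends nothing if $\vec q_E$ is empty). It ends when $C$ finishes processing the last query; $\mathsf{state}'_C$ is $C$'s final state. A *simulator* $\mathsf{Sim}$ is a (possibly inefficient, randomized) algorithm taking $(\vec q_E,R_C,\mathsf{state}_C)$, with $R_C$ on a tape of which it may overwrite finitely many bits; its output $R'_C$ is the final content of that tape. **Deletion-as-control.** $C$ satisfies $(\varepsilon,\delta)$-deletion-as-control if there exists $\mathsf{Sim}$ such that for all $E$ and $Y$, in the experiment $R_C\sim\mathcal U$; $(\tau,\mathsf{state}_C)\gets\langle C(R_C),E,Y\rangle$; $R'_C\gets\mathsf{Sim}(\vec q_E,R_C,\mathsf{state}_C)$; $(\tau',\mathsf{state}'_C)\gets\langle C(R'_C),D(\vec q_E)\rangle$: (1) $R'_C\approx_{\varepsilon,\delta}R_C$; and (2) with probability at least $1-\delta$, $\mathsf{state}'_C=\mathsf{state}_C$ or $\mathsf{state}_C=\bot$.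
   Formalization: The claim is proved only for environments and data subjects such that, given their coins, the execution ends with probability 0 or 1 over the controller's coins, and for controllers whose coin use, given E's queries, is bounded uniformly over Y's queries; without these it is false. *)

theory Defs
  imports "HOL-Probability.Probability" "HOL-Library.Finite_Map"
begin

section \<open>Random tapes and randomized programs\<close>

definition coins :: "bool stream measure" where
  "coins = stream_space (measure_pmf (bernoulli_pmf (1/2)))"

text \<open>
  A program reading a read-once tape of random bits. As this is an inductive datatype, every
  program halts on every tape; this encodes that each activation of a party terminates.
\<close>

datatype 'a rand = Done 'a | Flip "bool \<Rightarrow> 'a rand"

primrec run :: "'a rand \<Rightarrow> bool stream \<Rightarrow> 'a \<times> bool stream" where
  "run (Done a) r = (a, r)"
| "run (Flip f) r = run (f (shd r)) (stl r)"

primrec bind_rand :: "'a rand \<Rightarrow> ('a \<Rightarrow> 'b rand) \<Rightarrow> 'b rand" where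
  "bind_rand (Done a) g = g a"
| "bind_rand (Flip f) g = Flip (\<lambda>b. bind_rand (f b) g)"

text \<open>The maximal number of random bits that a program reads.\<close>

primrec depth :: "'a rand \<Rightarrow> nat" where
  "depth (Done a) = 0"
| "depth (Flip f) = Suc (max (depth (f False)) (depth (f True)))"

definition law :: "'a rand \<Rightarrow> 'a measure" where
  "law p = distr coins (count_space UNIV) (\<lambda>r. fst (run p r))"

section \<open>Indistinguishability and differential privacy\<close>

definition indist :: "real \<Rightarrow> real \<Rightarrow> 'a measure \<Rightarrow> 'a measure \<Rightarrow> bool" where
  "indist \<epsilon> \<delta> P Q \<longleftrightarrow> sets P = sets Q \<and>
     (\<forall>A\<in>sets P. measure P A \<le> exp \<epsilon> * measure Q A + \<delta> \<and>
                  measure Q A \<le> exp \<epsilon> * measure P A + \<delta>)"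

type_synonym cid = nat

text \<open>
  A dataset has one coordinate per channel ID, with values in the universe \<open>'x\<close> extended by a value
  for ``no record''; all but finitely many coordinates carry no record.
\<close>

type_synonym 'x dataset = "(cid, 'x) fmap"

definition neighbors :: "'x dataset \<Rightarrow> 'x dataset \<Rightarrow> bool" where
  "neighbors x x' \<longleftrightarrow> (\<exists>i. \<forall>j. j \<noteq> i \<longrightarrow> fmlookup x j = fmlookup x' j)"

definition differentially_private :: "real \<Rightarrow> real \<Rightarrow> ('x dataset \<Rightarrow> 'o rand) \<Rightarrow> bool" where
  "differentially_private \<epsilon> \<delta> M \<longleftrightarrow>
     (\<forall>x x'. neighbors x x' \<longrightarrow> indist \<epsilon> \<delta> (law (M x)) (law (M x')))"

section \<open>Strongly history independent dictionaries\<close>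

datatype 'x dict_op = DInsert 'x | DDelete | DGet | DSet 'x

fun apply_op :: "'x dict_op \<times> cid \<Rightarrow> 'x dataset \<Rightarrow> 'x dataset" where
  "apply_op (DInsert v, k) m = (if k |\<in>| fmdom m then m else fmupd k v m)"
| "apply_op (DDelete, k) m = fmdrop k m"
| "apply_op (DGet, k) m = m"
| "apply_op (DSet v, k) m = (if k |\<in>| fmdom m then fmupd k v m else m)"

text \<open>
  An implementation with physical memory states in \<open>'p\<close>, of which \<open>states\<close> are the well-formed ones.
\<close>

record ('p, 'x) dictionary =
  states :: "'p set"
  contents :: "'p \<Rightarrow> 'x dataset"
  d_init :: "'p rand"
  d_op :: "'x dict_op \<times> cid \<Rightarrow> 'p \<Rightarrow> ('p \<times> 'x option) rand"

definition is_dictionary :: "('p, 'x) dictionary \<Rightarrow> bool" where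
  "is_dictionary d \<longleftrightarrow>
     (\<forall>p\<in>set_rand (d_init d). p \<in> states d \<and> contents d p = fmempty) \<and>
     (\<forall>p\<in>states d. \<forall>opn k. \<forall>(p', v)\<in>set_rand (d_op d (opn, k) p).
        p' \<in> states d \<and> contents d p' = apply_op (opn, k) (contents d p) \<and>
        (opn = DGet \<longrightarrow> v = fmlookup (contents d p) k))"

primrec exec_ops :: "('p, 'x) dictionary \<Rightarrow> ('x dict_op \<times> cid) list \<Rightarrow> 'p \<Rightarrow> 'p rand" where
  "exec_ops d [] p = Done p"
| "exec_ops d (a # as) p = bind_rand (d_op d a p) (\<lambda>(p', _). exec_ops d as p')"

definition strongly_history_independent :: "('p, 'x) dictionary \<Rightarrow> bool" where
  "strongly_history_independent d \<longleftrightarrow>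
     (\<forall>p\<in>states d. \<forall>as bs. fold apply_op as (contents d p) = fold apply_op bs (contents d p) \<longrightarrow>
        law (exec_ops d as p) = law (exec_ops d bs p))"

section \<open>Execution model\<close>

text \<open>\<open>Reply None\<close> is the answer bottom; \<open>Text\<close> is for arbitrary other communication.\<close>

datatype ('x, 'o) msg =
  Insert 'x | Delete | Get | Set 'x | Tick | Reply "'o option" | Text "bool list"

text \<open>
  A party is activated by a message, by the failure of its last sending attempt, or without any
  input. It updates its state and sends at most one message. The initial state may be
  computed from the random tape.
\<close>

datatype 'm input = Wake | Fail | Recv cid 'm

record ('s, 'm) machine =
  start :: "'s rand"
  act :: "'s \<Rightarrow> 'm input \<Rightarrow> ('s \<times> (cid \<times> 'm) option) rand"

datatype party = Controller | Environment | Subject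

record network =
  env_cids :: "cid set"
  subj_cid :: cid
  priv_cid :: cid

definition network_ok :: "network \<Rightarrow> bool" where
  "network_ok net \<longleftrightarrow> infinite (env_cids net) \<and> subj_cid net \<notin> env_cids net \<and>
     priv_cid net \<notin> env_cids net \<and> priv_cid net \<noteq> subj_cid net"

fun peer :: "network \<Rightarrow> party \<Rightarrow> cid \<Rightarrow> party option" where
  "peer net Controller c = (if c \<in> env_cids net then Some Environment
                            else if c = subj_cid net then Some Subject else None)"
| "peer net Environment c = (if c \<in> env_cids net then Some Controller
                             else if c = priv_cid net then Some Subject else None)"
| "peer net Subject c = (if c = subj_cid net then Some Controller
                         else if c = priv_cid net then Some Environment else None)"

text \<open>
  The subject cannot send \<open>Tick\<close> to the controller: the attempt fails as on an invalid channel.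
\<close>

definition route :: "network \<Rightarrow> party \<Rightarrow> cid \<Rightarrow> ('x, 'o) msg \<Rightarrow> party option" where
  "route net p c m =
     (if p = Subject \<and> peer net p c = Some Controller \<and> m = Tick then None else peer net p c)"

subsection \<open>Real execution\<close>

text \<open>
  Work tapes of the environment and of the subject hold bit strings. Entries of \<open>trace\<close> consist of
  sender, receiver, channel ID and message.
\<close>

type_synonym ('x, 'o) transcript = "(party \<times> party \<times> cid \<times> ('x, 'o) msg) list"
type_synonym ('x, 'o) query = "cid \<times> ('x, 'o) msg"
type_synonym ('x, 'o) outside_party = "(bool list, ('x, 'o) msg) machine"

record ('s, 'x, 'o) config =
  st_C :: 's
  st_E :: "bool list"
  st_Y :: "bool list"
  tape_C :: "bool stream"
  tape_E :: "bool stream"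
  tape_Y :: "bool stream"
  turn :: party
  inbox :: "('x, 'o) msg input"
  trace :: "('x, 'o) transcript"
  ended :: bool

fun dispatch :: "network \<Rightarrow> party \<Rightarrow> ('x, 'o) query option \<Rightarrow>
    ('s, 'x, 'o) config \<Rightarrow> ('s, 'x, 'o) config" where
  "dispatch net p None cf = cf\<lparr>turn := Environment, inbox := Wake\<rparr>"
| "dispatch net p (Some (c, m)) cf =
     (case route net p c m of
        None \<Rightarrow> cf\<lparr>turn := p, inbox := Fail\<rparr>
      | Some p' \<Rightarrow> cf\<lparr>turn := p', inbox := Recv c m,
          trace := trace cf @ (if p = Controller \<or> p' = Controller then [(p, p', c, m)] else [])\<rparr>)"

definition step :: "network \<Rightarrow> ('s, ('x, 'o) msg) machine \<Rightarrow> ('x, 'o) outside_party \<Rightarrow>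
    ('x, 'o) outside_party \<Rightarrow> ('s, 'x, 'o) config \<Rightarrow> ('s, 'x, 'o) config" where
  "step net C E Y cf =
     (if ended cf then cf else
      case turn cf of
        Controller \<Rightarrow>
          (case run (act C (st_C cf) (inbox cf)) (tape_C cf) of
             ((s, out), r) \<Rightarrow> dispatch net Controller out
               (cf\<lparr>st_C := s, tape_C := r, ended := (inbox cf = Recv (subj_cid net) Delete)\<rparr>))
      | Environment \<Rightarrow>
          (case run (act E (st_E cf) (inbox cf)) (tape_E cf) of
             ((s, out), r) \<Rightarrow> dispatch net Environment out (cf\<lparr>st_E := s, tape_E := r\<rparr>))
      | Subject \<Rightarrow>
          (case run (act Y (st_Y cf) (inbox cf)) (tape_Y cf) of
             ((s, out), r) \<Rightarrow> dispatch net Subject out (cf\<lparr>st_Y := s, tape_Y := r\<rparr>)))"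

definition initial :: "('s, ('x, 'o) msg) machine \<Rightarrow> ('x, 'o) outside_party \<Rightarrow>
    ('x, 'o) outside_party \<Rightarrow> bool stream \<Rightarrow> bool stream \<Rightarrow> bool stream \<Rightarrow> ('s, 'x, 'o) config" where
  "initial C E Y R rE rY =
     \<lparr>st_C = fst (run (start C) R), st_E = fst (run (start E) rE), st_Y = fst (run (start Y) rY),
      tape_C = snd (run (start C) R), tape_E = snd (run (start E) rE), tape_Y = snd (run (start Y) rY),
      turn = Environment, inbox = Wake, trace = [], ended = False\<rparr>"

definition config_at :: "network \<Rightarrow> ('s, ('x, 'o) msg) machine \<Rightarrow> ('x, 'o) outside_party \<Rightarrow>
    ('x, 'o) outside_party \<Rightarrow> bool stream \<Rightarrow> bool stream \<Rightarrow> bool stream \<Rightarrow> nat \<Rightarrow>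
    ('s, 'x, 'o) config" where
  "config_at net C E Y R rE rY n = (step net C E Y ^^ n) (initial C E Y R rE rY)"

definition ends :: "network \<Rightarrow> ('s, ('x, 'o) msg) machine \<Rightarrow> ('x, 'o) outside_party \<Rightarrow>
    ('x, 'o) outside_party \<Rightarrow> bool stream \<Rightarrow> bool stream \<Rightarrow> bool stream \<Rightarrow> bool" where
  "ends net C E Y R rE rY \<longleftrightarrow> (\<exists>n. ended (config_at net C E Y R rE rY n))"

text \<open>Transcript and final state of the controller, where \<open>None\<close> is the state bottom.\<close>

definition real_exec :: "network \<Rightarrow> ('s, ('x, 'o) msg) machine \<Rightarrow> ('x, 'o) outside_party \<Rightarrow>
    ('x, 'o) outside_party \<Rightarrow> bool stream \<Rightarrow> bool stream \<Rightarrow> bool stream \<Rightarrow>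
    ('x, 'o) transcript \<times> 's option" where
  "real_exec net C E Y R rE rY =
     (if ends net C E Y R rE rY
      then let cf = config_at net C E Y R rE rY (LEAST n. ended (config_at net C E Y R rE rY n))
           in (trace cf, Some (st_C cf))
      else ([], None))"

definition env_queries :: "('x, 'o) transcript \<Rightarrow> ('x, 'o) query list" where
  "env_queries \<tau> =
     map (\<lambda>(p, p', q). q) (filter (\<lambda>(p, p', q). p = Environment \<and> p' = Controller) \<tau>)"

subsection \<open>Ideal execution\<close>

text \<open>
  The dummy holds the other end of all channels of the controller. The third component is the
  pending input of the controller, or \<open>None\<close> if it is the turn of the dummy; the last one
  consists of the queries that the dummy has not sent yet.
\<close>

type_synonym ('s, 'x, 'o) ideal_config =
  "'s \<times> bool stream \<times> ('x, 'o) msg input option \<times> ('x, 'o) query list"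

fun ideal_step :: "network \<Rightarrow> ('s, ('x, 'o) msg) machine \<Rightarrow>
    ('s, 'x, 'o) ideal_config \<Rightarrow> ('s, 'x, 'o) ideal_config" where
  "ideal_step net C (s, r, None, []) = (s, r, None, [])"
| "ideal_step net C (s, r, None, (c, m) # qs) = (s, r, Some (Recv c m), qs)"
| "ideal_step net C (s, r, Some i, qs) =
     (case run (act C s i) r of
        ((s', out), r') \<Rightarrow>
          (s', r',
           (case out of None \<Rightarrow> None
            | Some (c, m) \<Rightarrow> if peer net Controller c = None then Some Fail else None),
           qs))"

definition ideal_exec :: "network \<Rightarrow> ('s, ('x, 'o) msg) machine \<Rightarrow> ('x, 'o) query list \<Rightarrow>
    bool stream \<Rightarrow> 's option" where
  "ideal_exec net C qs R =
     (let cf = (\<lambda>n. (ideal_step net C ^^ n) (fst (run (start C) R), snd (run (start C) R), None, qs));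
          fin = (\<lambda>(s, r, i, rest). i = None \<and> rest = [])
      in if \<exists>n. fin (cf n) then Some (fst (cf (LEAST n. fin (cf n)))) else None)"

section \<open>Deletion-as-control\<close>

text \<open>
  The simulator receives the queries of the environment, the tape and the final state (or bottom) of
  the controller, and a random tape of its own. It returns the bits that overwrite an
  initial segment of the controller's tape; any finite set of changed positions lies in such a segment.
\<close>

type_synonym ('s, 'x, 'o) simulator =
  "('x, 'o) query list \<Rightarrow> bool stream \<Rightarrow> 's option \<Rightarrow> bool stream \<Rightarrow> bool list"

definition overwrite :: "bool list \<Rightarrow> bool stream \<Rightarrow> bool stream" where
  "overwrite w R = w @- sdrop (length w) R"

text \<open>
  \<open>Adv\<close> is the class of pairs of an environment and a subject, with the network connecting
  them to the controller; \<open>Adv = UNIV\<close> imposes no restriction. The components of \<open>\<omega>\<close> are the random tapes of the controller, the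
  environment, the subject and the simulator.
\<close>

definition deletion_as_control_against ::
    "(network \<times> ('x, 'o) outside_party \<times> ('x, 'o) outside_party) set \<Rightarrow> real \<Rightarrow> real \<Rightarrow>
     ('s::countable, ('x, 'o) msg) machine \<Rightarrow> bool" where
  "deletion_as_control_against Adv \<epsilon> \<delta> C \<longleftrightarrow>
     (\<exists>Sim :: ('s, 'x, 'o) simulator.
        (\<forall>q s. (\<lambda>(R, r). Sim q R s r) \<in> measurable (coins \<Otimes>\<^sub>M coins) (count_space UNIV)) \<and>
        (\<forall>net E Y. network_ok net \<longrightarrow> (net, E, Y) \<in> Adv \<longrightarrow>
           (let \<Omega> = coins \<Otimes>\<^sub>M coins \<Otimes>\<^sub>M coins \<Otimes>\<^sub>M coins;
                q_E = (\<lambda>(R, rE, rY, r). env_queries (fst (real_exec net C E Y R rE rY)));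
                state = (\<lambda>(R, rE, rY, r). snd (real_exec net C E Y R rE rY));
                R' = (\<lambda>(R, rE, rY, r).
                        overwrite (Sim (q_E (R, rE, rY, r)) R (state (R, rE, rY, r)) r) R);
                state' = (\<lambda>\<omega>. ideal_exec net C (q_E \<omega>) (R' \<omega>))
            in indist \<epsilon> \<delta> (distr \<Omega> coins R') coins \<and>
               measure \<Omega> {\<omega> \<in> space \<Omega>. state' \<omega> = state \<omega> \<or> state \<omega> = None} \<ge> 1 - \<delta>)))"

text \<open>
  Whether the real execution ends may depend on the coins of the environment and of the subject, but
  not on those of the controller. Adversaries that end the execution with probability 1
  qualify, as do those that never end it. For other adversaries, deletion-as-control can fail for
  a differentially private controller: after an execution that never ends the simulator sees
  only the controller's tape, whose law conditioned on this event can be chosen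
  by an adversary that reacts to the published output.
\<close>

definition ending_oblivious :: "('s, ('x, 'o) msg) machine \<Rightarrow>
    (network \<times> ('x, 'o) outside_party \<times> ('x, 'o) outside_party) set" where
  "ending_oblivious C = {(net, E, Y).
     AE (rE, rY) in coins \<Otimes>\<^sub>M coins.
       (AE R in coins. ends net C E Y R rE rY) \<or> (AE R in coins. \<not> ends net C E Y R rE rY)}"

text \<open>
  For given queries of the environment, the number of random bits read by the controller is bounded
  uniformly in the queries that the subject (on channel \<open>y\<close>) interleaves. Without
  such a bound a simulator that changes finitely many bits cannot reach all bits that may be
  correlated with the controller's state.
\<close>

primrec serve :: "('s, ('x, 'o) msg) machine \<Rightarrow> ('x, 'o) query list \<Rightarrow> 's \<Rightarrow> 's rand" where
  "serve C [] s = Done s"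
| "serve C (q # qs) s = bind_rand (act C s (Recv (fst q) (snd q))) (\<lambda>(s', _). serve C qs s')"

definition coin_bounded :: "('s, ('x, 'o) msg) machine \<Rightarrow> bool" where
  "coin_bounded C \<longleftrightarrow>
     (\<forall>q_E. \<exists>N. \<forall>y qs. filter (\<lambda>(c, m). c \<noteq> y) qs = q_E \<longrightarrow> (y, Tick) \<notin> set qs \<longrightarrow>
        depth (bind_rand (start C) (serve C qs)) \<le> N)"

section \<open>The DP machine learning controller\<close>

text \<open>
  \<open>Collecting p\<close>: the dictionary has physical state \<open>p\<close>, and \<open>out\<close> is bottom.
  \<open>Published m\<close>: the dictionary has been erased, and \<open>out\<close> is \<open>m\<close>.
\<close>

datatype ('p, 'o) dpml_state = Collecting 'p | Published 'o

instance dpml_state :: (countable, countable) countable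
  by countable_datatype

fun dict_op_of :: "('x, 'o) msg \<Rightarrow> 'x dict_op option" where
  "dict_op_of (Insert v) = Some (DInsert v)"
| "dict_op_of (Set v) = Some (DSet v)"
| "dict_op_of Get = Some DGet"
| "dict_op_of Delete = Some DDelete"
| "dict_op_of _ = None"

fun dpml_act :: "('p, 'x) dictionary \<Rightarrow> ('x dataset \<Rightarrow> 'o rand) \<Rightarrow> ('p, 'o) dpml_state \<Rightarrow>
    ('x, 'o) msg input \<Rightarrow> (('p, 'o) dpml_state \<times> ('x, 'o) query option) rand" where
  "dpml_act d M (Collecting p) (Recv c Tick) =
     bind_rand (M (contents d p)) (\<lambda>m. Done (Published m, Some (c, Reply (Some m))))"
| "dpml_act d M (Collecting p) (Recv c m) =
     (case dict_op_of m of
        None \<Rightarrow> Done (Collecting p, Some (c, Reply None))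
      | Some opn \<Rightarrow> bind_rand (d_op d (opn, c) p)
          (\<lambda>(p', _). Done (Collecting p', Some (c, Reply None))))"
| "dpml_act d M (Published m) (Recv c _) = Done (Published m, Some (c, Reply (Some m)))"
| "dpml_act d M s _ = Done (s, None)"

definition dpml_controller :: "('p, 'x) dictionary \<Rightarrow> ('x dataset \<Rightarrow> 'o rand) \<Rightarrow>
    (('p, 'o) dpml_state, ('x, 'o) msg) machine" where
  "dpml_controller d M =
     \<lparr>start = bind_rand (d_init d) (\<lambda>p. Done (Collecting p)), act = dpml_act d M\<rparr>"

end

theory Submission
  imports Defs
begin

text \<open>
  The simulator replaces the prefix of the tape that the controller may have read by a fresh prefix,
  drawn by rejection sampling from the coins conditioned on the event that the ideal execution ends in the
  given state. Let \<open>P\<close> be the law of the controller's state at the end of the real execution and \<open>Q\<close> its law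
  in the ideal execution, for fixed tapes of the environment and the subject. The simulated tape is then
  a mixture with weights \<open>P\<close> of the conditional laws of the coins given the state, and the coins themselves
  are the mixture of the same conditional laws with weights \<open>Q\<close>. So indistinguishability of \<open>P\<close> and \<open>Q\<close>
  carries over to the tapes by post-processing, and simulation fails only on states of
  \<open>Q\<close>-mass zero, which have \<open>P\<close>-mass at most \<open>\<delta>\<close>.

  If the subject deletes before the tick, \<open>P\<close> and \<open>Q\<close> agree by strong history independence, since the
  logical contents are those produced by the queries of the environment alone. If the subject deletes after
  the tick, the state is the output of \<open>M\<close> on one of two datasets that differ at most in the subject's
  record. Later queries of the environment may depend on the published output, but they neither
  change the state nor consume coins.
\<close>

section \<open>Random tapes and rejection sampling\<close>

lemma space_coins [simp]: "space coins = UNIV"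
  by (simp add: coins_def space_stream_space)

lemma prob_space_coins: "prob_space coins"
  unfolding coins_def by (intro prob_space.prob_space_stream_space measure_pmf.prob_space_axioms)

interpretation coins: prob_space coins
  by (rule prob_space_coins)

lemma emeasure_coins_UNIV [simp]: "emeasure coins UNIV = 1"
  using coins.emeasure_space_1 by simp

lemma measurable_coins [measurable]:
  "shd \<in> coins \<rightarrow>\<^sub>M count_space UNIV"
  "stl \<in> coins \<rightarrow>\<^sub>M coins"
  "sdrop n \<in> coins \<rightarrow>\<^sub>M coins"
  "stake n \<in> coins \<rightarrow>\<^sub>M count_space UNIV"
  "(\<lambda>r. b ## r) \<in> coins \<rightarrow>\<^sub>M coins"
  "(\<lambda>r. w @- r) \<in> coins \<rightarrow>\<^sub>M coins"
proof -
  have s: "sets coins = sets (stream_space (count_space UNIV))"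
    unfolding coins_def by (intro sets_stream_space_cong) simp
  show "shd \<in> coins \<rightarrow>\<^sub>M count_space UNIV"
    unfolding measurable_cong_sets[OF s refl] by simp
  show stl: "stl \<in> coins \<rightarrow>\<^sub>M coins"
    unfolding measurable_cong_sets[OF s s] by simp
  show "sdrop n \<in> coins \<rightarrow>\<^sub>M coins"
    unfolding measurable_cong_sets[OF s s] by simp
  show "stake n \<in> coins \<rightarrow>\<^sub>M count_space UNIV"
    unfolding measurable_cong_sets[OF s refl] by simp
  show C: "(\<lambda>r. b ## r) \<in> coins \<rightarrow>\<^sub>M coins" for b
    unfolding measurable_cong_sets[OF s s] by simp
  show "(\<lambda>r. w @- r) \<in> coins \<rightarrow>\<^sub>M coins"
  proof (induction w)
    case (Cons b w)
    from measurable_compose[OF Cons C] show ?case by simp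
  qed simp
qed

lemma nn_integral_coins:
  assumes f: "f \<in> borel_measurable coins"
  shows "(\<integral>\<^sup>+R. f R \<partial>coins) = (\<integral>\<^sup>+b. (\<integral>\<^sup>+R. f (b ## R) \<partial>coins) \<partial>bernoulli_pmf (1/2))"
  using prob_space.nn_integral_stream_space[OF measure_pmf.prob_space_axioms f[unfolded coins_def]]
  by (simp add: coins_def)

lemma nn_integral_sdrop:
  assumes [measurable]: "f \<in> borel_measurable coins"
  shows "(\<integral>\<^sup>+R. f (sdrop n R) \<partial>coins) = (\<integral>\<^sup>+R. f R \<partial>coins)"
proof (induction n)
  case (Suc n)
  then show ?case
    by (subst nn_integral_coins) (simp_all add: ennreal_mult'[symmetric] field_simps flip: ring_distribs)
qed simp

section \<open>Distributions of programs\<close>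

primrec pmf_of_rand :: "'a rand \<Rightarrow> 'a pmf" where
  "pmf_of_rand (Done a) = return_pmf a"
| "pmf_of_rand (Flip f) = bind_pmf (bernoulli_pmf (1/2)) (\<lambda>b. pmf_of_rand (f b))"

lemma pmf_of_rand_bind:
  "pmf_of_rand (bind_rand p g) = bind_pmf (pmf_of_rand p) (\<lambda>a. pmf_of_rand (g a))"
  by (induction p) (simp_all add: bind_return_pmf bind_assoc_pmf)

lemma set_pmf_of_rand: "set_pmf (pmf_of_rand p) = set_rand p"
  by (induction p) auto

lemma finite_set_rand: "finite (set_rand p)"
  by (induction p) auto

lemma fst_run_in_set_rand: "fst (run p R) \<in> set_rand p"
proof (induction p arbitrary: R)
  case (Flip f)
  then have "fst (run (f (shd R)) (stl R)) \<in> set_rand (f (shd R))" by blast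
  then show ?case by auto
qed simp

lemma depth_Flip_le:
  assumes "depth (Flip f) \<le> N"
  obtains N' where "N = Suc N'" "\<And>b. depth (f b) \<le> N'"
proof -
  obtain N' where "N = Suc N'" using assms by (cases N) auto
  moreover have "depth (f b) \<le> N'" for b using assms calculation by (cases b) auto
  ultimately show ?thesis using that by blast
qed

lemma measurable_run_sdrop:
  assumes "depth p \<le> N" and [measurable]: "\<And>a. G a \<in> coins \<rightarrow>\<^sub>M K"
  shows "(\<lambda>R. G (fst (run p R)) (sdrop N R)) \<in> coins \<rightarrow>\<^sub>M K"
  using assms(1)
proof (induction p arbitrary: N)
  case (Flip f)
  then obtain N' where N': "N = Suc N'" "\<And>b. depth (f b) \<le> N'" using depth_Flip_le by blast
  have [measurable]: "(\<lambda>R. G (fst (run (f b) R)) (sdrop N' R)) \<in> coins \<rightarrow>\<^sub>M K" for b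
    using Flip.IH N'(2) by blast
  have "(\<lambda>R. if shd R then G (fst (run (f True) (stl R))) (sdrop N' (stl R))
       else G (fst (run (f False) (stl R))) (sdrop N' (stl R))) \<in> coins \<rightarrow>\<^sub>M K"
    by measurable
  also have "(\<lambda>R. if shd R then G (fst (run (f True) (stl R))) (sdrop N' (stl R))
       else G (fst (run (f False) (stl R))) (sdrop N' (stl R))) =
      (\<lambda>R. G (fst (run (Flip f) R)) (sdrop N R))"
    by (auto simp: N')
  finally show ?case .
qed simp

text \<open>A program may stop reading earlier on some branches than on others. Cutting the tape at
  the fixed position \<open>N\<close>, rather than where reading stopped, makes the tail fresh and
  independent of the result.\<close>

lemma nn_integral_run_sdrop:
  assumes "depth p \<le> N" and [measurable]: "\<And>a. G a \<in> borel_measurable coins"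
  shows "(\<integral>\<^sup>+R. G (fst (run p R)) (sdrop N R) \<partial>coins) =
    (\<integral>\<^sup>+a. (\<integral>\<^sup>+R. G a R \<partial>coins) \<partial>pmf_of_rand p)"
  using assms(1)
proof (induction p arbitrary: N)
  case (Done a)
  then show ?case by (simp add: nn_integral_sdrop)
next
  case (Flip f)
  then obtain N' where N': "N = Suc N'" "\<And>b. depth (f b) \<le> N'" using depth_Flip_le by blast
  have "(\<integral>\<^sup>+R. G (fst (run (Flip f) R)) (sdrop N R) \<partial>coins) =
      (\<integral>\<^sup>+b. (\<integral>\<^sup>+R. G (fst (run (f b) R)) (sdrop N' R) \<partial>coins) \<partial>bernoulli_pmf (1/2))"
    using measurable_run_sdrop[OF Flip.prems, of G]
    by (subst nn_integral_coins) (auto simp: N')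
  also have "\<dots> = (\<integral>\<^sup>+b. (\<integral>\<^sup>+a. (\<integral>\<^sup>+R. G a R \<partial>coins) \<partial>pmf_of_rand (f b)) \<partial>bernoulli_pmf (1/2))"
    using Flip.IH N'(2) by simp
  finally show ?case by (simp add: nn_integral_bind_pmf)
qed

lemma measurable_fst_run [measurable]: "(\<lambda>R. fst (run p R)) \<in> coins \<rightarrow>\<^sub>M count_space UNIV"
  using measurable_run_sdrop[of p "depth p" "\<lambda>a _. a"] by simp

lemma measurable_snd_run [measurable]: "(\<lambda>R. snd (run p R)) \<in> coins \<rightarrow>\<^sub>M coins"
proof (induction p)
  case (Flip f)
  have [measurable]: "(\<lambda>R. snd (run (f b) R)) \<in> coins \<rightarrow>\<^sub>M coins" for b
    using Flip by blast
  have "(\<lambda>R. if shd R then snd (run (f True) (stl R)) else snd (run (f False) (stl R)))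
      \<in> coins \<rightarrow>\<^sub>M coins"
    by measurable
  also have "(\<lambda>R. if shd R then snd (run (f True) (stl R)) else snd (run (f False) (stl R))) =
      (\<lambda>R. snd (run (Flip f) R))"
    by auto
  finally show ?case .
qed simp

text \<open>Links the tape semantics to discrete distributions, so that laws can be computed with
  the monad laws of \<open>pmf\<close>.\<close>

lemma law_eq_measure_pmf: "law p = measure_pmf (pmf_of_rand p)"
proof (rule measure_eqI)
  fix A assume "A \<in> sets (law p)"
  have "emeasure (law p) A = (\<integral>\<^sup>+a. indicator A a \<partial>law p)"
    by (simp add: law_def)
  also have "\<dots> = (\<integral>\<^sup>+R. indicator A (fst (run p R)) \<partial>coins)"
    unfolding law_def by (subst nn_integral_distr) simp_all
  also have "\<dots> = (\<integral>\<^sup>+a. indicator A a \<partial>pmf_of_rand p)"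
    by (subst nn_integral_run_sdrop[OF order.refl, where G = "\<lambda>a _. indicator A a"])
      simp_all
  finally show "emeasure (law p) A = emeasure (pmf_of_rand p) A" by simp
qed (simp add: law_def)

lemma law_cong_pmf: "law p = law p' \<longleftrightarrow> pmf_of_rand p = pmf_of_rand p'"
  by (simp add: law_eq_measure_pmf measure_pmf_inject)

section \<open>Replacing a prefix or a tail of the tape\<close>

lemma fst_run_overwrite:
  assumes "depth p \<le> N"
  shows "fst (run p (stake N R @- R')) = fst (run p R)"
  using assms
proof (induction p arbitrary: N R)
  case (Flip f)
  then obtain N' where N': "N = Suc N'" "\<And>b. depth (f b) \<le> N'" using depth_Flip_le by blast
  then show ?case using Flip.IH by simp
qed simp

text \<open>The first \<open>N\<close> coins and the remaining ones are independent, so a fresh tail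
  changes no integral; the induction peels off one coin at a time.\<close>

lemma nn_integral_resample_tail:
  assumes "f \<in> borel_measurable coins"
  shows "(\<integral>\<^sup>+R. f R \<partial>coins) = (\<integral>\<^sup>+R. (\<integral>\<^sup>+R'. f (stake N R @- R') \<partial>coins) \<partial>coins)"
  using assms
proof (induction N arbitrary: f)
  case (Suc N)
  note [measurable] = Suc.prems
  have [measurable]: "(\<lambda>R. \<integral>\<^sup>+R'. f (stake n R @- R') \<partial>coins) \<in> borel_measurable coins" for n
    by (rule measurable_compose[where f = "stake n" and N = "count_space UNIV"
      and g = "\<lambda>w. \<integral>\<^sup>+R'. f (w @- R') \<partial>coins"]) auto
  have "(\<integral>\<^sup>+R. f R \<partial>coins) =
     (\<integral>\<^sup>+b. (\<integral>\<^sup>+R. (\<integral>\<^sup>+R'. f (b ## stake N R @- R') \<partial>coins) \<partial>coins) \<partial>bernoulli_pmf (1/2))"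
    by (subst nn_integral_coins, simp, intro nn_integral_cong Suc.IH) simp
  also have "\<dots> = (\<integral>\<^sup>+R. (\<integral>\<^sup>+R'. f (stake (Suc N) R @- R') \<partial>coins) \<partial>coins)"
    by (subst (2) nn_integral_coins) (auto)
  finally show ?case .
qed simp

text \<open>Attempt \<open>k\<close> inspects the stream from position \<open>k * N\<close> on. When
  \<open>good\<close> depends only on the first \<open>N\<close> bits and has positive probability,
  the attempts are independent trials and the result is a prefix conditioned on \<open>good\<close>.
  The default block keeps the length equal to \<open>N\<close> on every tape.\<close>

definition resample :: "nat \<Rightarrow> (bool stream \<Rightarrow> bool) \<Rightarrow> bool stream \<Rightarrow> bool list" where
  "resample N good r =
     (if \<exists>k. good (sdrop (k * N) r)
      then stake N (sdrop ((LEAST k. good (sdrop (k * N) r)) * N) r) else replicate N False)"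

lemma length_resample [simp]: "length (resample N good r) = N"
  by (simp add: resample_def)

text \<open>After a failed first attempt, the least successful index is one smaller on the tape
  without its first block.\<close>

lemma resample_rec:
  "resample N good r = (if good r then stake N r else resample N good (sdrop N r))"
proof (cases "good r")
  case True
  then have "(LEAST k. good (sdrop (k * N) r)) = 0"
    by (intro Least_equality) auto
  moreover have "\<exists>k. good (sdrop (k * N) r)" using True by (intro exI[of _ 0]) simp
  ultimately show ?thesis using True by (simp add: resample_def)
next
  case False
  have eq: "sdrop (k * N) (sdrop N r) = sdrop (Suc k * N) r" for k
    by (simp add: sdrop_add add.commute)
  have ex: "(\<exists>k. good (sdrop (k * N) r)) \<longleftrightarrow> (\<exists>k. good (sdrop (Suc k * N) r))"
    using False by (metis mult_0 not0_implies_Suc sdrop.simps(1))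
  show ?thesis
  proof (cases "\<exists>k. good (sdrop (k * N) r)")
    case True
    then obtain k where "good (sdrop (k * N) r)" by blast
    then have "(LEAST k. good (sdrop (k * N) r)) = Suc (LEAST k. good (sdrop (Suc k * N) r))"
      using False by (intro Least_Suc) auto
    then show ?thesis using True False ex unfolding resample_def eq by auto
  next
    case False
    then show ?thesis using \<open>\<not> good r\<close> ex unfolding resample_def eq by auto
  qed
qed

lemma measurable_resample [measurable]:
  assumes [measurable]: "Measurable.pred coins good"
  shows "resample N good \<in> coins \<rightarrow>\<^sub>M count_space UNIV"
proof -
  have [measurable]: "Measurable.pred coins (\<lambda>r. good (sdrop n r))" for n by measurable
  have [measurable]: "(\<lambda>r. stake N (sdrop ((LEAST k. good (sdrop (k * N) r)) * N) r))
      \<in> coins \<rightarrow>\<^sub>M count_space UNIV"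
    by (rule measurable_compose_countable[where f = "\<lambda>k r. stake N (sdrop (k * N) r)"]) measurable
  show ?thesis unfolding resample_def[abs_def] by measurable
qed

text \<open>
  Unrolling one round of the rejection sampler gives the equation
  \<open>E F(resample) = E [good; F(stake)] + P(not good) E F(resample)\<close>.
\<close>

lemma nn_integral_resample:
  fixes F :: "bool list \<Rightarrow> ennreal"
  assumes depth: "depth I \<le> N" and F: "\<And>w. F w \<le> 1"
  shows "ennreal (pmf (pmf_of_rand I) s) * (\<integral>\<^sup>+r. F (resample N (\<lambda>R. fst (run I R) = s) r) \<partial>coins) =
    (\<integral>\<^sup>+R. indicator {s} (fst (run I R)) * F (stake N R) \<partial>coins)"
proof -
  let ?S = "resample N (\<lambda>R. fst (run I R) = s)"
  let ?Q = "pmf_of_rand I"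
  let ?e = "\<integral>\<^sup>+r. F (?S r) \<partial>coins"
  let ?X = "\<integral>\<^sup>+R. indicator {s} (fst (run I R)) * F (stake N R) \<partial>coins"
  have [measurable]: "(\<lambda>r. F (?S r)) \<in> borel_measurable coins"
    by (rule measurable_compose[OF measurable_resample]) auto
  have [measurable]: "(\<lambda>r. F (stake N r)) \<in> borel_measurable coins"
    by (rule measurable_compose[where f = "stake N" and N = "count_space UNIV"]) auto
  \<comment> \<open>Finiteness of \<open>?e\<close> permits cancelling the rejection term in
    \<open>ennreal\<close> at the end.\<close>
  have "?e \<le> (\<integral>\<^sup>+r. 1 \<partial>coins)" by (intro nn_integral_mono F)
  then have fin: "?e \<noteq> \<top>" by (auto simp: top_unique)
  have i [measurable]: "(\<lambda>r. indicator A (fst (run I r)) :: ennreal) \<in> borel_measurable coins" for A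
    by (rule measurable_compose[OF measurable_fst_run]) simp
  have "?e = (\<integral>\<^sup>+r. indicator {s} (fst (run I r)) * F (stake N r) +
      indicator (-{s}) (fst (run I r)) * F (?S (sdrop N r)) \<partial>coins)"
    by (intro nn_integral_cong, subst resample_rec) (auto split: split_indicator)
  also have "\<dots> = ?X + (\<integral>\<^sup>+r. indicator (-{s}) (fst (run I r)) * F (?S (sdrop N r)) \<partial>coins)"
    by (intro nn_integral_add) measurable
  also have "(\<integral>\<^sup>+r. indicator (-{s}) (fst (run I r)) * F (?S (sdrop N r)) \<partial>coins) =
      (\<integral>\<^sup>+a. (\<integral>\<^sup>+r. indicator (-{s}) a * F (?S r) \<partial>coins) \<partial>?Q)"
    by (rule nn_integral_run_sdrop[OF depth, of "\<lambda>a r. indicator (-{s}) a * F (?S r)"]) measurable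
  also have "\<dots> = emeasure ?Q (-{s}) * ?e"
    by (simp add: nn_integral_cmult nn_integral_multc)
  finally have e: "?e = ?X + emeasure ?Q (-{s}) * ?e" .
  have "ennreal (pmf ?Q s) + emeasure ?Q (-{s}) = 1"
    using plus_emeasure[of "{s}" ?Q "-{s}"] measure_pmf.emeasure_space_1[of ?Q]
    by (simp add: emeasure_pmf_single)
  then have "?e = ennreal (pmf ?Q s) * ?e + emeasure ?Q (-{s}) * ?e"
    by (simp flip: distrib_right)
  moreover have "emeasure ?Q (-{s}) * ?e \<noteq> \<top>"
    using fin by (simp add: ennreal_mult_eq_top_iff)
  ultimately show ?thesis
    using e ennreal_add_left_cancel[of "emeasure ?Q (-{s}) * ?e" "ennreal (pmf ?Q s) * ?e" ?X]
    by (simp add: add.commute)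
qed

section \<open>Resampling a tape conditioned on the outcome of a program\<close>

lemma measurable_overwrite [measurable (raw)]:
  assumes [measurable]: "W \<in> M \<rightarrow>\<^sub>M count_space UNIV" "X \<in> M \<rightarrow>\<^sub>M coins"
  shows "(\<lambda>x. overwrite (W x) (X x)) \<in> M \<rightarrow>\<^sub>M coins"
proof (rule measurable_compose_countable[where f = "\<lambda>w x. overwrite w (X x)"])
  show "(\<lambda>x. overwrite w (X x)) \<in> M \<rightarrow>\<^sub>M coins" for w
    unfolding overwrite_def by measurable
qed measurable

lemma measure_run_eq: "measure coins {R. fst (run p R) = s} = pmf (pmf_of_rand p) s"
proof -
  have "measure coins {R. fst (run p R) = s} = measure (law p) {s}"
    unfolding law_def by (subst measure_distr) (auto intro!: arg_cong[where f = "measure coins"])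
  then show ?thesis by (simp add: law_eq_measure_pmf measure_pmf_single)
qed

text \<open>The new prefix comes from the simulator's own coins, and the kept tail is independent of
  the outcome of \<open>p\<close>. Hence, once \<open>p\<close> has ended in \<open>s\<close>, the
  new tape has the law of the coins given that \<open>I\<close> ends in \<open>s\<close>.
  Multiplying by the mass of \<open>s\<close> under \<open>I\<close> avoids a division.\<close>

lemma nn_integral_resampled_tape:
  assumes p: "depth p \<le> N" and I: "depth I \<le> N" and [measurable]: "A \<in> sets coins"
  shows "ennreal (pmf (pmf_of_rand I) s) *
      (\<integral>\<^sup>+r. \<integral>\<^sup>+R. indicator {s} (fst (run p R)) *
         indicator A (overwrite (resample N (\<lambda>R. fst (run I R) = s) r) R) \<partial>coins \<partial>coins) =
    ennreal (pmf (pmf_of_rand p) s) * emeasure coins {R \<in> A. fst (run I R) = s}"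
proof -
  let ?S = "resample N (\<lambda>R. fst (run I R) = s)"
  define F :: "bool list \<Rightarrow> ennreal" where "F w = (\<integral>\<^sup>+R. indicator A (w @- R) \<partial>coins)" for w
  have F_le: "F w \<le> 1" for w
  proof -
    have "F w \<le> (\<integral>\<^sup>+R. 1 \<partial>coins)"
      unfolding F_def by (intro nn_integral_mono) (auto split: split_indicator)
    then show ?thesis by simp
  qed
  have [measurable]: "(\<lambda>r. F (?S r)) \<in> borel_measurable coins"
    by (rule measurable_compose[OF measurable_resample]) auto
  have [measurable]: "(\<lambda>r. F (stake N r)) \<in> borel_measurable coins"
    by (rule measurable_compose[where f = "stake N" and N = "count_space UNIV"]) auto
  have i [measurable]: "(\<lambda>r. indicator B (fst (run I r)) :: ennreal) \<in> borel_measurable coins" for B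
    by (rule measurable_compose[OF measurable_fst_run]) simp
  have "(\<integral>\<^sup>+R. indicator {s} (fst (run p R)) * indicator A (w @- sdrop N R) \<partial>coins) =
      ennreal (pmf (pmf_of_rand p) s) * F w" for w
    by (subst nn_integral_run_sdrop[OF p, of "\<lambda>a R. indicator {s} a * indicator A (w @- R)"])
      (simp_all add: nn_integral_cmult nn_integral_multc F_def emeasure_pmf_single)
  then have "(\<integral>\<^sup>+r. \<integral>\<^sup>+R. indicator {s} (fst (run p R)) *
         indicator A (overwrite (?S r) R) \<partial>coins \<partial>coins) =
      ennreal (pmf (pmf_of_rand p) s) * (\<integral>\<^sup>+r. F (?S r) \<partial>coins)"
    by (simp add: overwrite_def nn_integral_cmult)
  moreover have "ennreal (pmf (pmf_of_rand I) s) * (\<integral>\<^sup>+r. F (?S r) \<partial>coins) =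
      (\<integral>\<^sup>+R. indicator {s} (fst (run I R)) * F (stake N R) \<partial>coins)"
    by (rule nn_integral_resample[OF I F_le])
  \<comment> \<open>\<open>I\<close> reads only the first \<open>N\<close> bits, so the test of its
    outcome can be moved under the integral over the fresh tail; the tail is then absorbed into one
    full tape.\<close>
  moreover have "\<dots> = (\<integral>\<^sup>+R. (\<integral>\<^sup>+R'. indicator {s} (fst (run I (stake N R @- R'))) *
      indicator A (stake N R @- R') \<partial>coins) \<partial>coins)"
    unfolding F_def by (simp add: fst_run_overwrite[OF I] nn_integral_cmult)
  moreover have "\<dots> = (\<integral>\<^sup>+R. indicator {s} (fst (run I R)) * indicator A R \<partial>coins)"
    by (rule nn_integral_resample_tail[symmetric]) measurable
  moreover have "\<dots> = (\<integral>\<^sup>+R. indicator {R \<in> A. fst (run I R) = s} R \<partial>coins)"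
    by (intro nn_integral_cong) (auto split: split_indicator)
  moreover have "{R \<in> A. fst (run I R) = s} \<in> sets coins"
  proof -
    have "{R \<in> A. fst (run I R) = s} = A \<inter> {R \<in> space coins. fst (run I R) = s}" by auto
    also have "\<dots> \<in> sets coins" by measurable
    finally show ?thesis .
  qed
  ultimately show ?thesis
    by (simp add: mult.left_commute[of "ennreal (pmf (pmf_of_rand I) s)"])
qed

text \<open>
  The worst test function is the indicator of the set where \<open>p\<close> exceeds \<open>c\<close> times \<open>q\<close>.
\<close>

lemma pmf_post_processing:
  fixes p q :: "'a pmf"
  assumes U: "finite U" "set_pmf p \<subseteq> U" "set_pmf q \<subseteq> U"
    and le: "\<And>A. measure p A \<le> c * measure q A + \<delta>"
    and f: "\<And>x. 0 \<le> f x" "\<And>x. f x \<le> 1"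
  shows "(\<Sum>x\<in>U. pmf p x * f x) \<le> c * (\<Sum>x\<in>U. pmf q x * f x) + (\<delta>::real)"
proof -
  let ?B = "{x \<in> U. pmf p x \<ge> c * pmf q x}"
  have "(\<Sum>x\<in>U. (pmf p x - c * pmf q x) * f x) \<le> (\<Sum>x\<in>U. if x \<in> ?B then pmf p x - c * pmf q x else 0)"
  proof (intro sum_mono)
    fix x assume "x \<in> U"
    then show "(pmf p x - c * pmf q x) * f x \<le> (if x \<in> ?B then pmf p x - c * pmf q x else 0)"
      using mult_left_le[OF f(2), of "pmf p x - c * pmf q x" x] f(1)[of x]
      by (auto simp: mult_nonpos_nonneg)
  qed
  also have "\<dots> = (\<Sum>x\<in>?B. pmf p x - c * pmf q x)"
    using U(1) by (intro sum.mono_neutral_cong_right) auto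
  also have "\<dots> = measure p ?B - c * measure q ?B"
    using U(1) by (simp add: measure_measure_pmf_finite sum_subtractf sum_distrib_left)
  also have "\<dots> \<le> \<delta>" using le[of ?B] by simp
  finally show ?thesis by (simp add: algebra_simps sum_subtractf sum_distrib_left)
qed

lemma indist_pmf_iff:
  "indist \<epsilon> \<delta> (measure_pmf p) (measure_pmf q) \<longleftrightarrow>
     (\<forall>A. measure p A \<le> exp \<epsilon> * measure q A + \<delta> \<and> measure q A \<le> exp \<epsilon> * measure p A + \<delta>)"
  by (simp add: indist_def)

text \<open>The simulator seen for fixed tapes of the environment and the subject:
  \<open>g R\<close> is the final real state. The prefix length depends on the state because the
  queries known to the simulator may depend on the published output.\<close>

definition resimulate ::
    "(bool stream \<Rightarrow> 's) \<Rightarrow> 's rand \<Rightarrow> ('s \<Rightarrow> nat) \<Rightarrow> bool stream \<Rightarrow> bool stream \<Rightarrow> bool stream" where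
  "resimulate g I N R r =
     (let s = g R in
      overwrite (if s \<in> set_rand I then resample (N s) (\<lambda>R. fst (run I R) = s) r else []) R)"

lemma measurable_resimulate:
  fixes p I :: "'s::countable rand"
  shows "(\<lambda>(r, R). resimulate (\<lambda>R. fst (run p R)) I N R r) \<in> coins \<Otimes>\<^sub>M coins \<rightarrow>\<^sub>M coins"
proof -
  have "(\<lambda>x. if fst (run p (snd x)) \<in> set_rand I
      then resample (N (fst (run p (snd x)))) (\<lambda>R. fst (run I R) = fst (run p (snd x))) (fst x)
      else []) \<in> coins \<Otimes>\<^sub>M coins \<rightarrow>\<^sub>M count_space UNIV"
  proof (rule measurable_compose_countable[where g = "\<lambda>x. fst (run p (snd x))" and
      f = "\<lambda>s x. if s \<in> set_rand I then resample (N s) (\<lambda>R. fst (run I R) = s) (fst x) else []"])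
    show "(\<lambda>x. if s \<in> set_rand I then resample (N s) (\<lambda>R. fst (run I R) = s) (fst x) else [])
        \<in> coins \<Otimes>\<^sub>M coins \<rightarrow>\<^sub>M count_space UNIV" for s
      by measurable
  qed measurable
  then show ?thesis unfolding resimulate_def Let_def case_prod_beta by measurable
qed

text \<open>Both tape laws mix the same conditional laws, with the laws of \<open>p\<close> and of
  \<open>I\<close> as weights, so \<open>pmf_post_processing\<close> compares them with the
  conditional probabilities of \<open>A\<close> as test function. Iterated integrals prepare for
  averaging over the tapes of the other parties.\<close>

lemma resimulate_indist:
  fixes p I :: "'s::countable rand"
  assumes indist: "indist \<epsilon> \<delta> (law p) (law I)"
    and depth: "\<And>s. s \<in> set_rand p \<Longrightarrow> depth p \<le> N s \<and> depth I \<le> N s"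
  defines "R' \<equiv> resimulate (\<lambda>R. fst (run p R)) I N"
  shows "\<And>A. A \<in> sets coins \<Longrightarrow>
      (\<integral>\<^sup>+r. \<integral>\<^sup>+R. indicator A (R' R r) \<partial>coins \<partial>coins)
        \<le> ennreal (exp \<epsilon>) * emeasure coins A + ennreal \<delta>" (is "\<And>A. _ A \<Longrightarrow> ?up A")
    and "\<And>A. A \<in> sets coins \<Longrightarrow> emeasure coins A
        \<le> ennreal (exp \<epsilon>) * (\<integral>\<^sup>+r. \<integral>\<^sup>+R. indicator A (R' R r) \<partial>coins \<partial>coins) + ennreal \<delta>"
      (is "\<And>A. _ A \<Longrightarrow> ?lo A")
    and "(\<integral>\<^sup>+r. \<integral>\<^sup>+R. indicator {s. fst (run I (R' R r)) = s} (fst (run p R)) \<partial>coins \<partial>coins)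
        \<ge> ennreal (1 - \<delta>)"
proof -
  let ?P = "pmf_of_rand p" and ?Q = "pmf_of_rand I"
  let ?U = "set_rand p \<union> set_rand I"
  have le: "measure ?P A \<le> exp \<epsilon> * measure ?Q A + \<delta>" "measure ?Q A \<le> exp \<epsilon> * measure ?P A + \<delta>" for A
    using indist unfolding law_eq_measure_pmf indist_pmf_iff by auto
  have \<delta>: "0 \<le> \<delta>" using le(1)[of "{}"] by simp
  have pmf_0: "pmf (pmf_of_rand p') s = 0" if "s \<notin> set_rand p'" for s and p' :: "'s rand"
    using that by (simp add: pmf_eq_0_set_pmf set_pmf_of_rand)
  note [measurable] = measurable_resimulate[of p I N, folded R'_def]
  have [measurable]: "(\<lambda>R. indicator B (fst (run p' R)) :: ennreal) \<in> borel_measurable coins"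
    for B and p' :: "'s rand"
    by (rule measurable_compose[OF measurable_fst_run]) simp
  \<comment> \<open>The probability that the real state is \<open>s\<close> and the simulated tape
    lies in \<open>A\<close>.\<close>
  define T where "T A s = (\<integral>\<^sup>+r. \<integral>\<^sup>+R. indicator {s} (fst (run p R)) * indicator A (R' R r) \<partial>coins \<partial>coins)"
    for A s
  \<comment> \<open>The common kernel. Where \<open>I\<close> can reach \<open>s\<close>, it
    conditions the coins on \<open>I\<close> ending in \<open>s\<close>. Elsewhere the simulator
    keeps the tape, which leaves the coins conditioned on \<open>p\<close> ending in
    \<open>s\<close>. Outside both supports division by zero gives 0, so the values stay in the unit
    interval.\<close>
  define f where "f A s =
    (if s \<in> set_rand I then measure coins {R \<in> A. fst (run I R) = s} / pmf ?Q s
     else measure coins {R \<in> A. fst (run p R) = s} / pmf ?P s)" for A s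
  have sets_run: "{R \<in> A. fst (run p' R) = s} \<in> sets coins" if [measurable]: "A \<in> sets coins"
    for A s and p' :: "'s rand"
  proof -
    have "{R \<in> A. fst (run p' R) = s} = A \<inter> {R \<in> space coins. fst (run p' R) = s}" by auto
    also have "\<dots> \<in> sets coins" by measurable
    finally show ?thesis .
  qed
  have le_pmf: "measure coins {R \<in> A. fst (run p' R) = s} \<le> pmf (pmf_of_rand p') s"
    for A s and p' :: "'s rand"
    using sets_run[of UNIV p' s] sets.top[of coins]
    unfolding measure_run_eq[symmetric] by (intro coins.finite_measure_mono) auto
  have f: "0 \<le> f A s" "f A s \<le> 1" for A s
    using le_pmf[of A I s] le_pmf[of A p s]
    by (auto simp: f_def divide_le_eq_1 pmf_nonneg less_le)
  have T: "T A s = ennreal (pmf ?P s * f A s)" if A [measurable]: "A \<in> sets coins" and s: "s \<in> set_rand p" for A s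
  proof (cases "s \<in> set_rand I")
    case True
    then have pos: "pmf ?Q s > 0" by (simp add: pmf_positive_iff set_pmf_of_rand)
    have "T A s = (\<integral>\<^sup>+r. \<integral>\<^sup>+R. indicator {s} (fst (run p R)) *
         indicator A (overwrite (resample (N s) (\<lambda>R. fst (run I R) = s) r) R) \<partial>coins \<partial>coins)"
      unfolding T_def R'_def resimulate_def using True
      by (intro nn_integral_cong) (auto split: split_indicator)
    then have "ennreal (pmf ?Q s) * T A s = ennreal (pmf ?P s) * emeasure coins {R \<in> A. fst (run I R) = s}"
      using nn_integral_resampled_tape[OF _ _ A, of p "N s" I s] depth[OF s] by simp
    also have "\<dots> = ennreal (pmf ?Q s) * ennreal (pmf ?P s * f A s)"
      using True pos by (simp add: f_def coins.emeasure_eq_measure flip: ennreal_mult)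
    finally show ?thesis using pos by (simp add: ennreal_mult_cancel_left)
  next
    case False
    have "T A s = (\<integral>\<^sup>+(r::bool stream). \<integral>\<^sup>+R. indicator {R \<in> A. fst (run p R) = s} R \<partial>coins \<partial>coins)"
      unfolding T_def R'_def resimulate_def using False
      by (intro nn_integral_cong) (auto split: split_indicator simp: overwrite_def)
    also have "\<dots> = emeasure coins {R \<in> A. fst (run p R) = s}"
      using sets_run[OF A] by simp
    finally show ?thesis using False s
      by (simp add: f_def coins.emeasure_eq_measure set_pmf_of_rand set_pmf_iff[symmetric])
  qed
  have x: "(\<integral>\<^sup>+r. \<integral>\<^sup>+R. indicator A (R' R r) \<partial>coins \<partial>coins) = ennreal (\<Sum>s\<in>?U. pmf ?P s * f A s)"
    if A [measurable]: "A \<in> sets coins" for A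
  proof -
    have "(\<integral>\<^sup>+r. \<integral>\<^sup>+R. indicator A (R' R r) \<partial>coins \<partial>coins) =
        (\<integral>\<^sup>+r. \<integral>\<^sup>+R. (\<Sum>s\<in>set_rand p. indicator {s} (fst (run p R)) * indicator A (R' R r)) \<partial>coins \<partial>coins)"
    proof (intro nn_integral_cong)
      fix r R
      have "(\<Sum>s\<in>set_rand p. indicator {s} (fst (run p R)) * indicator A (R' R r)) =
          (\<Sum>s\<in>set_rand p. if s = fst (run p R) then indicator A (R' R r) else 0 :: ennreal)"
        by (intro sum.cong) auto
      then show "indicator A (R' R r) =
          (\<Sum>s\<in>set_rand p. indicator {s} (fst (run p R)) * indicator A (R' R r) :: ennreal)"
        by (simp add: finite_set_rand fst_run_in_set_rand)
    qed
    also have "\<dots> = (\<Sum>s\<in>set_rand p. T A s)"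
      unfolding T_def by (simp add: nn_integral_sum)
    also have "\<dots> = (\<Sum>s\<in>set_rand p. ennreal (pmf ?P s * f A s))"
      using T[OF A] by simp
    also have "\<dots> = (\<Sum>s\<in>?U. ennreal (pmf ?P s * f A s))"
      by (intro sum.mono_neutral_left) (auto simp: finite_set_rand pmf_0)
    finally show ?thesis using f by (simp add: sum_ennreal)
  qed
  have y: "emeasure coins A = ennreal (\<Sum>s\<in>?U. pmf ?Q s * f A s)"
    if A [measurable]: "A \<in> sets coins" for A
  proof -
    \<comment> \<open>The outcomes of \<open>I\<close> partition the tapes, which exhibits the coins
      as the mixture with the weights of \<open>I\<close>.\<close>
    have "measure coins A = measure coins (\<Union>s\<in>set_rand I. {R \<in> A. fst (run I R) = s})"
      by (rule arg_cong[where f = "measure coins"]) (auto simp: fst_run_in_set_rand)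
    also have "\<dots> = (\<Sum>s\<in>set_rand I. measure coins {R \<in> A. fst (run I R) = s})"
      by (intro coins.finite_measure_finite_Union)
        (auto simp: finite_set_rand sets_run[OF A] disjoint_family_on_def)
    also have "\<dots> = (\<Sum>s\<in>set_rand I. pmf ?Q s * f A s)"
      by (intro sum.cong refl) (auto simp: f_def set_pmf_of_rand set_pmf_iff[symmetric])
    also have "\<dots> = (\<Sum>s\<in>?U. pmf ?Q s * f A s)"
      by (intro sum.mono_neutral_left) (auto simp: finite_set_rand pmf_0)
    finally show ?thesis by (simp add: coins.emeasure_eq_measure)
  qed
  have U: "finite ?U" "set_pmf ?P \<subseteq> ?U" "set_pmf ?Q \<subseteq> ?U"
    by (auto simp: finite_set_rand set_pmf_of_rand)
  have nn: "0 \<le> (\<Sum>s\<in>?U. pmf q s * f A s)" for q A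
    using f by (intro sum_nonneg) auto
  show "?up A" if A: "A \<in> sets coins" for A
    using pmf_post_processing[OF U le(1), of "f A"] f[of A] nn \<delta>
    by (simp add: x[OF A] y[OF A] flip: ennreal_mult ennreal_plus)
  show "?lo A" if A: "A \<in> sets coins" for A
    using pmf_post_processing[OF U(1,3,2) le(2), of "f A"] f[of A] nn \<delta>
    by (simp add: x[OF A] y[OF A] flip: ennreal_mult ennreal_plus)
  let ?V = "set_rand p \<inter> set_rand I"
  let ?A = "\<lambda>s. {R. fst (run I R) = s}"
  have A: "?A s \<in> sets coins" for s using sets_run[of UNIV I s] sets.top[of coins] by simp
  \<comment> \<open>Simulation is hopeless only on states that \<open>I\<close> cannot reach;
    indistinguishability applied to this one event bounds their mass under \<open>p\<close>.\<close>
  have "measure ?Q (-set_rand I) = 0"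
    unfolding measure_pmf_zero_iff by (simp add: set_pmf_of_rand)
  then have "measure ?P (-set_rand I) \<le> \<delta>"
    using le(1)[of "-set_rand I"] by simp
  then have "1 - \<delta> \<le> measure ?P (set_rand I)"
    using measure_pmf.prob_compl[of "set_rand I" ?P] by (simp add: Compl_eq_Diff_UNIV)
  also have "measure ?P (set_rand I) = measure ?P ?V"
    using measure_Int_set_pmf[of ?P "set_rand I"] by (simp add: set_pmf_of_rand Int_commute)
  also have "\<dots> = (\<Sum>s\<in>?V. pmf ?P s)"
    by (simp add: finite_set_rand measure_measure_pmf_finite)
  \<comment> \<open>Given that \<open>I\<close> ends in \<open>s\<close>, the event
    \<open>?A s\<close> is certain, so the new factor is 1.\<close>
  also have "\<dots> = (\<Sum>s\<in>?V. pmf ?P s * f (?A s) s)"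
  proof (intro sum.cong refl)
    fix s assume "s \<in> ?V"
    then have "pmf ?Q s > 0" by (simp add: pmf_positive_iff set_pmf_of_rand)
    then show "pmf ?P s = pmf ?P s * f (?A s) s"
      using \<open>s \<in> ?V\<close> by (simp add: f_def measure_run_eq)
  qed
  finally have "ennreal (1 - \<delta>) \<le> ennreal (\<Sum>s\<in>?V. pmf ?P s * f (?A s) s)" by (rule ennreal_leI)
  also have "\<dots> = (\<Sum>s\<in>?V. T (?A s) s)"
    using f by (subst sum_ennreal[symmetric]) (simp_all add: T[OF A])
  also have "\<dots> = (\<integral>\<^sup>+r. \<integral>\<^sup>+R. (\<Sum>s\<in>?V. indicator {s} (fst (run p R)) * indicator (?A s) (R' R r)) \<partial>coins \<partial>coins)"
    unfolding T_def using A by (simp add: nn_integral_sum)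
  also have "\<dots> \<le> (\<integral>\<^sup>+r. \<integral>\<^sup>+R. indicator {s. fst (run I (R' R r)) = s} (fst (run p R)) \<partial>coins \<partial>coins)"
  proof (intro nn_integral_mono)
    fix r R
    have "(\<Sum>s\<in>?V. indicator {s} (fst (run p R)) * indicator (?A s) (R' R r)) =
        (\<Sum>s\<in>?V. if s = fst (run p R) then indicator (?A s) (R' R r) else 0 :: ennreal)"
      by (intro sum.cong) auto
    also have "\<dots> \<le> indicator {s. fst (run I (R' R r)) = s} (fst (run p R))"
      by (auto simp: finite_set_rand split: split_indicator)
    finally show "(\<Sum>s\<in>?V. indicator {s} (fst (run p R)) * indicator (?A s) (R' R r)) \<le>
        (indicator {s. fst (run I (R' R r)) = s} (fst (run p R)) :: ennreal)" .
  qed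
  finally show "(\<integral>\<^sup>+r. \<integral>\<^sup>+R. indicator {s. fst (run I (R' R r)) = s} (fst (run p R)) \<partial>coins \<partial>coins)
        \<ge> ennreal (1 - \<delta>)" .
qed

section \<open>Programs that serve a list of queries\<close>

lemma bind_rand_assoc: "bind_rand (bind_rand p f) g = bind_rand p (\<lambda>a. bind_rand (f a) g)"
  by (induction p) auto

lemma bind_rand_Done [simp]: "bind_rand p Done = p"
  by (induction p) auto

lemma set_bind_rand: "set_rand (bind_rand p f) = (\<Union>a\<in>set_rand p. set_rand (f a))"
  by (induction p) auto

lemma bind_rand_cong:
  "(\<And>a. a \<in> set_rand p \<Longrightarrow> f a = g a) \<Longrightarrow> bind_rand p f = bind_rand p g"
  by (induction p) auto

definition session :: "('s, ('x, 'o) msg) machine \<Rightarrow> ('x, 'o) query list \<Rightarrow> 's rand" where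
  "session C qs = bind_rand (start C) (serve C qs)"

lemma serve_append: "serve C (qs @ qs') s = bind_rand (serve C qs s) (serve C qs')"
  by (induction qs arbitrary: s) (auto simp: bind_rand_assoc intro!: bind_rand_cong)

lemma session_append: "session C (qs @ qs') = bind_rand (session C qs) (serve C qs')"
  by (simp add: session_def serve_append[abs_def] bind_rand_assoc)

lemma dpml_controller_simps [simp]:
  "start (dpml_controller d M) = bind_rand (d_init d) (\<lambda>p. Done (Collecting p))"
  "act (dpml_controller d M) = dpml_act d M"
  by (simp_all add: dpml_controller_def)

lemma serve_Published: "serve (dpml_controller d M) qs (Published m) = Done (Published m)"
  by (induction qs) simp_all

lemma serve_Tick:
  "serve (dpml_controller d M) ((c, Tick) # qs) s = serve (dpml_controller d M) [(c, Tick)] s"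
  by (cases s) (simp_all add: serve_Published bind_rand_assoc)

text \<open>Once published, the controller neither changes its state nor reads coins, so later
  queries disappear from the program itself and not merely from its law. This removes the effect of
  queries chosen after seeing the output.\<close>

lemma session_Tick:
  "session (dpml_controller d M) (qs @ (c, Tick) # qs') = session (dpml_controller d M) (qs @ [(c, Tick)])"
  unfolding session_append by (intro bind_rand_cong serve_Tick)

section \<open>Logical contents of the dictionary\<close>

definition ops_of :: "('x, 'o) query list \<Rightarrow> ('x dict_op \<times> cid) list" where
  "ops_of qs = List.map_filter (\<lambda>(c, m). map_option (\<lambda>opn. (opn, c)) (dict_op_of m)) qs"

lemma ops_of_simps [simp]:
  "ops_of [] = []"
  "ops_of ((c, m) # qs) =
     (case dict_op_of m of None \<Rightarrow> ops_of qs | Some opn \<Rightarrow> (opn, c) # ops_of qs)"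
  by (auto simp: ops_of_def List.map_filter_simps split: option.split)

lemma ops_of_append [simp]: "ops_of (qs @ qs') = ops_of qs @ ops_of qs'"
  by (induction qs) (auto split: option.split)

lemma ops_of_filter:
  "ops_of (filter (\<lambda>(c, m). c \<noteq> y) qs) = filter (\<lambda>(opn, c). c \<noteq> y) (ops_of qs)"
proof (induction qs)
  case (Cons q qs)
  obtain c m where "q = (c, m)" by (cases q)
  then show ?case using Cons by (cases "dict_op_of m") simp_all
qed simp

lemma serve_Collecting:
  assumes "Tick \<notin> snd ` set qs"
  shows "serve (dpml_controller d M) qs (Collecting p) =
    bind_rand (exec_ops d (ops_of qs) p) (\<lambda>p'. Done (Collecting p'))"
  using assms
proof (induction qs arbitrary: p)
  case (Cons q qs)
  obtain c m where q: "q = (c, m)" by (cases q)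
  then show ?case using Cons
    by (cases m) (simp_all add: bind_rand_assoc case_prod_beta)
qed simp

lemma exec_ops_contents:
  assumes "is_dictionary d" "p \<in> states d" "p' \<in> set_rand (exec_ops d ops p)"
  shows "contents d p' = fold apply_op ops (contents d p)"
  using assms(2,3)
proof (induction ops arbitrary: p)
  case (Cons a ops)
  obtain opn k where a: "a = (opn, k)" by (cases a)
  obtain p1 v where p1: "(p1, v) \<in> set_rand (d_op d (opn, k) p)" "p' \<in> set_rand (exec_ops d ops p1)"
    using Cons.prems by (auto simp: a set_bind_rand)
  then have "p1 \<in> states d \<and> contents d p1 = apply_op (opn, k) (contents d p)"
    using assms(1) Cons.prems(1) unfolding is_dictionary_def by blast
  then show ?case using Cons.IH[of p1] p1(2) by (simp add: a)
qed simp

lemma fmlookup_apply_op_other: "j \<noteq> k \<Longrightarrow> fmlookup (apply_op (opn, k) m) j = fmlookup m j"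
  by (cases opn) auto

lemma fmlookup_apply_op_cong:
  assumes "fmlookup m k = fmlookup m' k"
  shows "fmlookup (apply_op (opn, k) m) k = fmlookup (apply_op (opn, k) m') k"
proof -
  have "k |\<in>| fmdom m \<longleftrightarrow> k |\<in>| fmdom m'" using assms by (simp add: fmlookup_dom_iff)
  then show ?thesis using assms by (cases opn) auto
qed

text \<open>Each operation reads and writes its own key only. The induction needs two maps because
  the contents drift apart at \<open>y\<close>.\<close>

lemma fmlookup_fold_filter:
  assumes "j \<noteq> y" "fmlookup m j = fmlookup m' j"
  shows "fmlookup (fold apply_op ops m) j =
    fmlookup (fold apply_op (filter (\<lambda>(opn, c). c \<noteq> y) ops) m') j"
  using assms(2)
proof (induction ops arbitrary: m m')
  case (Cons a ops)
  obtain opn k where a: "a = (opn, k)" by (cases a)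
  show ?case
  proof (cases "k = y")
    case True
    then show ?thesis using Cons assms(1) by (simp add: a fmlookup_apply_op_other)
  next
    case False
    have "fmlookup (apply_op (opn, k) m) j = fmlookup (apply_op (opn, k) m') j"
      using Cons.prems by (cases "j = k") (auto simp: fmlookup_apply_op_other intro: fmlookup_apply_op_cong)
    then show ?thesis using Cons.IH False by (simp add: a)
  qed
qed simp

lemma fmlookup_fold_untouched:
  "fmlookup (fold apply_op (filter (\<lambda>(opn, c). c \<noteq> y) ops) m) y = fmlookup m y"
  by (induction ops arbitrary: m) (auto simp: fmlookup_apply_op_other)

section \<open>Final states with and without the queries of the subject\<close>

text \<open>The empty and the full event give \<open>0 \<le> \<delta>\<close> and
  \<open>1 \<le> exp \<epsilon> + \<delta>\<close>, which make every law indistinguishable from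
  itself. This replaces a sign condition on \<open>\<epsilon>\<close>.\<close>

lemma indist_refl:
  assumes "indist \<epsilon> \<delta> (law p) (law p)"
  shows "indist \<epsilon> \<delta> (law q) (law q)"
proof -
  have \<delta>: "0 \<le> \<delta>" "1 \<le> exp \<epsilon> + \<delta>"
    using assms[unfolded law_eq_measure_pmf indist_pmf_iff, rule_format, of "{}"]
      assms[unfolded law_eq_measure_pmf indist_pmf_iff, rule_format, of UNIV]
    by auto
  have "x \<le> exp \<epsilon> * x + \<delta>" if "0 \<le> x" "x \<le> 1" for x :: real
    using mult_right_mono[OF \<delta>(2) that(1)] mult_left_le[OF that(2) \<delta>(1)] by (simp add: algebra_simps)
  then show ?thesis by (simp add: law_eq_measure_pmf indist_pmf_iff)
qed

lemma indist_map_pmf: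
  assumes "indist \<epsilon> \<delta> (measure_pmf p) (measure_pmf q)"
  shows "indist \<epsilon> \<delta> (map_pmf f p) (map_pmf f q)"
  using assms by (simp add: indist_pmf_iff)

context
  fixes d :: "('p, 'x) dictionary" and M :: "'x dataset \<Rightarrow> 'o rand" and \<epsilon> \<delta> :: real
  assumes d: "is_dictionary d"
begin

lemma pmf_session_Collecting:
  assumes "Tick \<notin> snd ` set qs"
  shows "pmf_of_rand (session (dpml_controller d M) qs) =
    bind_pmf (pmf_of_rand (d_init d)) (\<lambda>p. map_pmf Collecting (pmf_of_rand (exec_ops d (ops_of qs) p)))"
  by (simp add: session_def bind_rand_assoc pmf_of_rand_bind map_pmf_def serve_Collecting[OF assms])

text \<open>Training depends on the memory only through its logical contents, which the operations
  determine, so the randomness of the dictionary averages out.\<close>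

lemma pmf_session_Tick:
  assumes "Tick \<notin> snd ` set qs"
  shows "pmf_of_rand (session (dpml_controller d M) (qs @ (c, Tick) # qs')) =
    map_pmf Published (pmf_of_rand (M (fold apply_op (ops_of qs) fmempty)))" (is "_ = ?R")
proof -
  have "pmf_of_rand (session (dpml_controller d M) (qs @ (c, Tick) # qs')) =
      bind_pmf (pmf_of_rand (d_init d)) (\<lambda>p. bind_pmf (pmf_of_rand (exec_ops d (ops_of qs) p))
        (\<lambda>p'. map_pmf Published (pmf_of_rand (M (contents d p')))))"
    by (subst session_Tick)
      (simp add: session_append pmf_of_rand_bind pmf_session_Collecting[OF assms] bind_assoc_pmf
        map_pmf_def bind_return_pmf bind_rand_assoc)
  also have "\<dots> = bind_pmf (pmf_of_rand (d_init d))
      (\<lambda>p. bind_pmf (pmf_of_rand (exec_ops d (ops_of qs) p)) (\<lambda>p'. ?R))"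
  proof (intro bind_pmf_cong refl)
    fix p p' assume "p \<in> set_pmf (pmf_of_rand (d_init d))"
      and p': "p' \<in> set_pmf (pmf_of_rand (exec_ops d (ops_of qs) p))"
    then have "p \<in> states d" "contents d p = fmempty"
      using d by (auto simp: is_dictionary_def set_pmf_of_rand)
    then show "map_pmf Published (pmf_of_rand (M (contents d p'))) = ?R"
      using exec_ops_contents[OF d _ p'[unfolded set_pmf_of_rand]] by simp
  qed
  finally show ?thesis by simp
qed

lemma session_indist:
  assumes hi: "strongly_history_independent d" and dp: "differentially_private \<epsilon> \<delta> M"
    and y: "(y, Tick) \<notin> set qs" and last: "Tick \<notin> snd ` set qs \<Longrightarrow> \<exists>qs'. qs = qs' @ [(y, Delete)]"
  shows "indist \<epsilon> \<delta> (law (session (dpml_controller d M) qs))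
    (law (session (dpml_controller d M) (filter (\<lambda>(c, m). c \<noteq> y) qs)))"
proof (cases "Tick \<in> snd ` set qs")
  case True
  then have "\<exists>q\<in>set qs. snd q = Tick" by force
  from split_list_first_prop[OF this] obtain qs0 q qs1
    where qs: "qs = qs0 @ q # qs1" "snd q = Tick" "\<forall>q\<in>set qs0. snd q \<noteq> Tick"
    by blast
  then obtain c where q: "q = (c, Tick)" by (cases q) auto
  let ?f = "filter (\<lambda>(c, m). c \<noteq> y)"
  \<comment> \<open>The first tick thus survives the filter, and both sessions train at this
    query.\<close>
  have c: "c \<noteq> y" using y qs q by auto
  \<comment> \<open>All discarded operations act on key \<open>y\<close>, the only coordinate in
    which the two datasets can differ.\<close>
  have "neighbors (fold apply_op (ops_of qs0) fmempty) (fold apply_op (ops_of (?f qs0)) fmempty)"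
    unfolding neighbors_def ops_of_filter by (intro exI[of _ y]) (auto intro: fmlookup_fold_filter)
  then have "indist \<epsilon> \<delta> (law (M (fold apply_op (ops_of qs0) fmempty)))
      (law (M (fold apply_op (ops_of (?f qs0)) fmempty)))"
    using dp by (simp add: differentially_private_def)
  moreover have "Tick \<notin> snd ` set qs0" "Tick \<notin> snd ` set (?f qs0)" using qs(3) by auto
  ultimately show ?thesis
    using c by (simp add: qs q law_eq_measure_pmf pmf_session_Tick indist_map_pmf)
next
  case False
  then obtain qs' where qs: "qs = qs' @ [(y, Delete)]" using last by blast
  let ?f = "filter (\<lambda>(c, m). c \<noteq> y)"
  have contents_eq: "fold apply_op (ops_of qs) fmempty = fold apply_op (ops_of (?f qs)) fmempty"
  proof (rule fmap_ext)
    fix j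
    show "fmlookup (fold apply_op (ops_of qs) fmempty) j =
        fmlookup (fold apply_op (ops_of (?f qs)) fmempty) j"
    proof (cases "j = y")
      case True
      \<comment> \<open>The final delete empties coordinate \<open>y\<close>; without the subject's
        operations it was never filled.\<close>
      have "fmlookup (fold apply_op (ops_of qs) fmempty) j = None" by (simp add: qs True)
      then show ?thesis by (simp add: True ops_of_filter fmlookup_fold_untouched)
    next
      case False
      then show ?thesis unfolding ops_of_filter by (intro fmlookup_fold_filter) simp_all
    qed
  qed
  have "pmf_of_rand (exec_ops d (ops_of qs) p) = pmf_of_rand (exec_ops d (ops_of (?f qs)) p)"
    if "p \<in> set_rand (d_init d)" for p
  proof -
    have p: "p \<in> states d" "contents d p = fmempty"
      using d that by (auto simp: is_dictionary_def)
    have "law (exec_ops d (ops_of qs) p) = law (exec_ops d (ops_of (?f qs)) p)"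
      using hi p(1) contents_eq unfolding strongly_history_independent_def p(2)[symmetric] by blast
    then show ?thesis by (simp only: law_cong_pmf)
  qed
  moreover have "Tick \<notin> snd ` set (?f qs)" using False by auto
  ultimately have "law (session (dpml_controller d M) qs) = law (session (dpml_controller d M) (?f qs))"
    unfolding law_cong_pmf pmf_session_Collecting[OF False] pmf_session_Collecting[OF \<open>Tick \<notin> snd ` set (?f qs)\<close>]
    by (intro bind_pmf_cong) (auto simp: set_pmf_of_rand)
  \<comment> \<open>Every dataset is its own neighbor, so privacy supplies the premise of
    \<open>indist_refl\<close>.\<close>
  moreover have "indist \<epsilon> \<delta> (law (M fmempty)) (law (M fmempty))"
    using dp by (simp add: differentially_private_def neighbors_def)
  ultimately show ?thesis by (simp add: indist_refl)
qed

end

section \<open>Executions that differ only in the tape of the controller\<close>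

lemma funpow_stable:
  assumes "P ((f ^^ m) x)" "\<And>z. P z \<Longrightarrow> f z = z" "m \<le> n"
  shows "(f ^^ n) x = (f ^^ m) x"
  using assms(3) by (induction n rule: dec_induct) (simp_all add: assms(1,2))

text \<open>Executions are read off at their first halting time, whereas proofs exhibit just some
  halting time. As halted configurations are fixed points, the result is the same.\<close>

lemma funpow_Least:
  assumes "P ((f ^^ n) x)" "\<And>z. P z \<Longrightarrow> f z = z"
  shows "(f ^^ (LEAST n. P ((f ^^ n) x))) x = (f ^^ n) x"
  using funpow_stable[where P = P and f = f and x = x and m = "LEAST n. P ((f ^^ n) x)" and n = n,
      OF _ assms(2)]
    LeastI[of "\<lambda>n. P ((f ^^ n) x)", OF assms(1)] Least_le[of "\<lambda>n. P ((f ^^ n) x)", OF assms(1)]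
  by simp

lemma run_bind: "run (bind_rand p f) R = run (f (fst (run p R))) (snd (run p R))"
  by (induction p arbitrary: R) auto

lemma session_Nil [simp]: "session C [] = start C"
proof -
  have "serve C [] = Done" by (rule ext) simp
  then show ?thesis by (simp add: session_def)
qed

lemma run_session_snoc:
  "run (session C (qs @ [(c, m)])) R =
     (let (s, r) = run (session C qs) R; ((s', out), r') = run (act C s (Recv c m)) r in (s', r'))"
  by (simp add: session_append run_bind case_prod_beta)

text \<open>The premise excludes answers on invalid channels, so the controller is never reactivated
  by \<open>Fail\<close> and processes exactly the queries in \<open>q\<close>.\<close>

lemma ideal_exec_eq:
  assumes "\<And>s c m x. (c, m) \<in> set q \<Longrightarrow> x \<in> set_rand (act C s (Recv c m)) \<Longrightarrow>
    case snd x of None \<Rightarrow> True | Some (c', m') \<Rightarrow> peer net Controller c' \<noteq> None"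
  shows "ideal_exec net C q R = Some (fst (run (session C q) R))"
proof -
  let ?x0 = "(fst (run (start C) R), snd (run (start C) R), None, q)"
  let ?f = "ideal_step net C"
  let ?fin = "\<lambda>(s, r, i, rest). i = None \<and> rest = ([] :: ('b, 'c) query list)"
  \<comment> \<open>Every query takes two steps: the dummy sends it, then the controller processes
    it.\<close>
  have eq: "(?f ^^ (2 * k)) ?x0 =
      (fst (run (session C (take k q)) R), snd (run (session C (take k q)) R), None, drop k q)"
    if "k \<le> length q" for k
    using that
  proof (induction k)
    case 0
    then show ?case by simp
  next
    case (Suc k)
    obtain c m where cm: "q ! k = (c, m)" by (cases "q ! k")
    have k: "k < length q" using Suc by simp
    then have tk: "take (Suc k) q = take k q @ [(c, m)]" "drop k q = (c, m) # drop (Suc k) q"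
      by (simp_all add: take_Suc_conv_app_nth cm Cons_nth_drop_Suc[symmetric])
    have mem: "(c, m) \<in> set q" using k cm by (metis nth_mem)
    obtain s r where sr: "run (session C (take k q)) R = (s, r)" by fastforce
    obtain s' out r' where act: "run (act C s (Recv c m)) r = ((s', out), r')"
      by (metis surj_pair)
    have "(s', out) \<in> set_rand (act C s (Recv c m))"
      using fst_run_in_set_rand[of "act C s (Recv c m)" r] act by simp
    from assms[OF mem this] have "?f (s, r, Some (Recv c m), drop (Suc k) q) = (s', r', None, drop (Suc k) q)"
      by (auto simp: act split: option.splits)
    moreover have "(?f ^^ (2 * Suc k)) ?x0 = ?f (?f ((?f ^^ (2 * k)) ?x0))" by simp
    ultimately show ?case
      using Suc.IH k by (simp add: sr tk(2)) (simp add: tk(1) run_session_snoc sr act)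
  qed
  have fin: "?fin ((?f ^^ (2 * length q)) ?x0)" by (simp add: eq)
  have fix_point: "?f z = z" if "?fin z" for z using that by (cases z) auto
  have "(?f ^^ (LEAST n. ?fin ((?f ^^ n) ?x0))) ?x0 = (?f ^^ (2 * length q)) ?x0"
    by (rule funpow_Least[of ?fin, OF fin fix_point])
  moreover have "\<exists>n. ?fin ((?f ^^ n) ?x0)" using fin by (rule exI)
  ultimately show ?thesis
    unfolding ideal_exec_def Let_def by (simp add: eq)
qed

lemma dpml_act_reply:
  "x \<in> set_rand (dpml_act d M s (Recv c m)) \<Longrightarrow> \<exists>v. snd x = Some (c, Reply v)"
  by (cases s; cases m) (auto simp: set_bind_rand)

lemma dpml_act_Collecting:
  "m \<noteq> Tick \<Longrightarrow> x \<in> set_rand (dpml_act d M (Collecting p) (Recv c m)) \<Longrightarrow>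
     \<exists>p'. x = (Collecting p', Some (c, Reply None))"
  by (cases m) (auto simp: set_bind_rand)

lemma dpml_act_Tick:
  "x \<in> set_rand (dpml_act d M (Collecting p) (Recv c Tick)) \<Longrightarrow>
     \<exists>v. x = (Published v, Some (c, Reply (Some v)))"
  by (auto simp: set_bind_rand)

lemma ideal_exec_dpml:
  assumes "fst ` set q \<subseteq> env_cids net"
  shows "ideal_exec net (dpml_controller d M) q R = Some (fst (run (session (dpml_controller d M) q) R))"
proof (rule ideal_exec_eq)
  fix s c m x assume "(c, m) \<in> set q" "x \<in> set_rand (act (dpml_controller d M) s (Recv c m))"
  moreover from this obtain v where "snd x = Some (c, Reply v)"
    using dpml_act_reply by fastforce
  ultimately show "case snd x of None \<Rightarrow> True | Some (c', m') \<Rightarrow> peer net Controller c' \<noteq> None"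
    using assms by auto
qed

section \<open>An invariant of the real execution\<close>

definition queries :: "('x, 'o) transcript \<Rightarrow> ('x, 'o) query list" where
  "queries \<tau> = map (\<lambda>(p, p', q). q) (filter (\<lambda>(p, p', q). p' = Controller) \<tau>)"

lemma queries_append [simp]: "queries (\<tau> @ \<tau>') = queries \<tau> @ queries \<tau>'"
  and queries_simps [simp]: "queries [] = []"
    "queries ((p, p', q) # \<tau>) = (if p' = Controller then q # queries \<tau> else queries \<tau>)"
  by (simp_all add: queries_def)

text \<open>A query enters the trace when it is sent. While it is the controller's turn, the last
  query is therefore still pending.\<close>

definition processed :: "('s, 'x, 'o) config \<Rightarrow> ('x, 'o) query list" where
  "processed cf = (if turn cf = Controller then butlast (queries (trace cf)) else queries (trace cf))"

lemma processed_eq_queries: "turn cf \<noteq> Controller \<Longrightarrow> processed cf = queries (trace cf)"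
  by (simp add: processed_def)

text \<open>What routing guarantees about messages to the controller. It allows the environment's
  queries to be recovered from the channel IDs alone.\<close>

definition admissible :: "network \<Rightarrow> ('x, 'o) transcript \<Rightarrow> bool" where
  "admissible net \<tau> \<longleftrightarrow> (\<forall>(p, p', c, m)\<in>set \<tau>. p' = Controller \<longrightarrow>
     p = Environment \<and> c \<in> env_cids net \<or> p = Subject \<and> c = subj_cid net \<and> m \<noteq> Tick)"

lemma admissible_simps [simp]:
  "admissible net []"
  "admissible net (\<tau> @ \<tau>') \<longleftrightarrow> admissible net \<tau> \<and> admissible net \<tau>'"
  "admissible net ((p, p', c, m) # \<tau>) \<longleftrightarrow> (p' = Controller \<longrightarrow>
     p = Environment \<and> c \<in> env_cids net \<or> p = Subject \<and> c = subj_cid net \<and> m \<noteq> Tick) \<and> admissible net \<tau>"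
  by (simp_all add: admissible_def ball_Un)

lemma env_queries_admissible:
  assumes "network_ok net" "admissible net \<tau>"
  shows "env_queries \<tau> = filter (\<lambda>(c, m). c \<noteq> subj_cid net) (queries \<tau>)"
    and "fst ` set (env_queries \<tau>) \<subseteq> env_cids net"
    and "fst ` set (queries \<tau>) \<subseteq> insert (subj_cid net) (env_cids net)"
    and "(subj_cid net, Tick) \<notin> set (queries \<tau>)"
proof -
  have "env_queries \<tau> = filter (\<lambda>(c, m). c \<noteq> subj_cid net) (queries \<tau>) \<and>
      fst ` set (env_queries \<tau>) \<subseteq> env_cids net \<and>
      fst ` set (queries \<tau>) \<subseteq> insert (subj_cid net) (env_cids net) \<and>
      (subj_cid net, Tick) \<notin> set (queries \<tau>)"
    using assms(2)
  proof (induction \<tau>)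
    case (Cons e \<tau>)
    obtain p p' c m where e: "e = (p, p', c, m)" by (cases e)
    have IH: "env_queries \<tau> = filter (\<lambda>(c, m). c \<noteq> subj_cid net) (queries \<tau>)"
      "fst ` set (env_queries \<tau>) \<subseteq> env_cids net"
      "fst ` set (queries \<tau>) \<subseteq> insert (subj_cid net) (env_cids net)"
      "(subj_cid net, Tick) \<notin> set (queries \<tau>)"
      using Cons.IH Cons.prems unfolding e admissible_simps by blast+
    have step: "env_queries (e # \<tau>) =
        (if p = Environment \<and> p' = Controller then (c, m) # env_queries \<tau> else env_queries \<tau>)"
      by (simp add: env_queries_def e)
    show ?case
    proof (cases "p' = Controller")
      case True
      then have "p = Environment \<and> c \<in> env_cids net \<or> p = Subject \<and> c = subj_cid net \<and> m \<noteq> Tick"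
        using Cons.prems by (simp add: e)
      then show ?thesis
        using IH assms(1) unfolding step network_ok_def by (elim disjE conjE) (simp_all add: e, blast)
    next
      case False
      then show ?thesis using IH unfolding step by (simp add: e)
    qed
  qed (simp add: env_queries_def)
  then show "env_queries \<tau> = filter (\<lambda>(c, m). c \<noteq> subj_cid net) (queries \<tau>)"
    "fst ` set (env_queries \<tau>) \<subseteq> env_cids net"
    "fst ` set (queries \<tau>) \<subseteq> insert (subj_cid net) (env_cids net)"
    "(subj_cid net, Tick) \<notin> set (queries \<tau>)"
    by blast+
qed

text \<open>The central clause says that the controller's work tape and unread random tape are what
  \<open>session\<close> yields on the queries processed so far. This reduces the interaction with
  adaptive parties to a program for a query list.\<close>

definition wf_config :: "network \<Rightarrow> ('s, ('x, 'o) msg) machine \<Rightarrow> bool stream \<Rightarrow> ('s, 'x, 'o) config \<Rightarrow> bool" where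
  "wf_config net C R cf \<longleftrightarrow> admissible net (trace cf) \<and>
     run (session C (processed cf)) R = (st_C cf, tape_C cf) \<and>
     (turn cf = Controller \<longrightarrow> \<not> ended cf \<and>
        (\<exists>c m. inbox cf = Recv c m \<and> queries (trace cf) = processed cf @ [(c, m)])) \<and>
     (ended cf \<longrightarrow> (\<exists>qs. queries (trace cf) = qs @ [(subj_cid net, Delete)]))"

text \<open>A message to the controller lengthens the trace but remains pending, so the processed
  queries stay the same.\<close>

lemma wf_config_dispatch:
  assumes "network_ok net" "wf_config net C R cf" "turn cf \<noteq> Controller" "\<not> ended cf" "p \<noteq> Controller"
  shows "wf_config net C R (dispatch net p out cf)"
    and "processed (dispatch net p out cf) = processed cf"
  using assms
  by (cases out; cases p; auto simp: wf_config_def processed_def route_def network_ok_def split: option.splits if_splits)+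

lemma step_ended: "ended cf \<Longrightarrow> step net C E Y cf = cf"
  by (simp add: step_def)

lemma step_Controller:
  assumes "turn cf = Controller" "\<not> ended cf"
    "run (act C (st_C cf) (inbox cf)) (tape_C cf) = ((s, out), r)"
  shows "step net C E Y cf = dispatch net Controller out
     (cf\<lparr>st_C := s, tape_C := r, ended := (inbox cf = Recv (subj_cid net) Delete)\<rparr>)"
  using assms by (simp add: step_def)

lemma step_Environment:
  assumes "turn cf = Environment" "\<not> ended cf"
    "run (act E (st_E cf) (inbox cf)) (tape_E cf) = ((s, out), r)"
  shows "step net C E Y cf = dispatch net Environment out (cf\<lparr>st_E := s, tape_E := r\<rparr>)"
  using assms by (simp add: step_def)

lemma step_Subject:
  assumes "turn cf = Subject" "\<not> ended cf"
    "run (act Y (st_Y cf) (inbox cf)) (tape_Y cf) = ((s, out), r)"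
  shows "step net C E Y cf = dispatch net Subject out (cf\<lparr>st_Y := s, tape_Y := r\<rparr>)"
  using assms by (simp add: step_def)

lemma step_Controller_wf:
  assumes net: "network_ok net" and wf: "wf_config net (dpml_controller d M) R cf"
    and Controller: "turn cf = Controller" and inbox: "inbox cf = Recv c m"
  shows "wf_config net (dpml_controller d M) R (step net (dpml_controller d M) E Y cf)"
    and "processed (step net (dpml_controller d M) E Y cf) = processed cf @ [(c, m)]"
proof -
  let ?C = "dpml_controller d M"
  let ?cf' = "step net ?C E Y cf"
  have cm: "inbox cf = Recv c m" "queries (trace cf) = processed cf @ [(c, m)]" and not_ended: "\<not> ended cf"
    using wf Controller inbox by (auto simp: wf_config_def)
  obtain s out r where act: "run (act ?C (st_C cf) (inbox cf)) (tape_C cf) = ((s, out), r)"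
    by (metis surj_pair)
  then have "(s, out) \<in> set_rand (dpml_act d M (st_C cf) (Recv c m))"
    using fst_run_in_set_rand[of "act ?C (st_C cf) (inbox cf)" "tape_C cf"] by (simp add: cm)
  from dpml_act_reply[OF this] obtain v where out: "out = Some (c, Reply v)" by auto
  \<comment> \<open>The answer goes back on the channel of the query, which is valid; hence the turn
    passes to another party and the pending query becomes a processed one.\<close>
  have "c \<in> insert (subj_cid net) (env_cids net)"
    using env_queries_admissible(3)[OF net, of "trace cf"] wf cm by (auto simp: wf_config_def)
  then obtain p' where p': "peer net Controller c = Some p'" "p' \<noteq> Controller"
    by (cases "c \<in> env_cids net") auto
  have cf': "?cf' = cf\<lparr>st_C := s, tape_C := r, ended := (inbox cf = Recv (subj_cid net) Delete),
      turn := p', inbox := Recv c (Reply v), trace := trace cf @ [(Controller, p', c, Reply v)]\<rparr>"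
    by (simp add: step_Controller[OF Controller not_ended act] out route_def p' del: peer.simps)
  have processed: "processed ?cf' = processed cf @ [(c, m)]"
    using p'(2) by (simp add: cf' processed_eq_queries cm(2))
  moreover have "run (session ?C (processed cf @ [(c, m)])) R = (s, r)"
    using wf act by (simp add: run_session_snoc wf_config_def cm(1) del: dpml_controller_simps)
  moreover have "admissible net (trace cf)" using wf by (simp add: wf_config_def)
  ultimately show "wf_config net ?C R ?cf'"
    unfolding wf_config_def processed using p'(2) by (simp add: cf' cm)
  show "processed ?cf' = processed cf @ [(c, m)]" by (fact processed)
qed

lemma wf_config_step:
  assumes net: "network_ok net" and wf: "wf_config net (dpml_controller d M) R cf"
  shows "wf_config net (dpml_controller d M) R (step net (dpml_controller d M) E Y cf)"
    and "\<exists>qs. processed (step net (dpml_controller d M) E Y cf) = processed cf @ qs"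
proof -
  let ?C = "dpml_controller d M"
  let ?cf' = "step net ?C E Y cf"
  have "wf_config net ?C R ?cf' \<and> (\<exists>qs. processed ?cf' = processed cf @ qs)"
  proof (cases "ended cf")
    case True
    then show ?thesis using wf by (simp add: step_ended)
  next
    case False
    show ?thesis
    proof (cases "turn cf")
      case Controller
      then show ?thesis
        using step_Controller_wf[OF net wf] wf by (auto simp: wf_config_def)
    next
      case Environment
      obtain s out r where act: "run (act E (st_E cf) (inbox cf)) (tape_E cf) = ((s, out), r)"
        by (metis surj_pair)
      have "wf_config net ?C R (cf\<lparr>st_E := s, tape_E := r\<rparr>)"
        using wf Environment by (simp add: wf_config_def processed_def)
      from wf_config_dispatch[OF net this, of Environment out] show ?thesis
        unfolding step_Environment[OF Environment False act]
        by (simp add: Environment False) (simp add: processed_def Environment)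
    next
      case Subject
      obtain s out r where act: "run (act Y (st_Y cf) (inbox cf)) (tape_Y cf) = ((s, out), r)"
        by (metis surj_pair)
      have "wf_config net ?C R (cf\<lparr>st_Y := s, tape_Y := r\<rparr>)"
        using wf Subject by (simp add: wf_config_def processed_def)
      from wf_config_dispatch[OF net this, of Subject out] show ?thesis
        unfolding step_Subject[OF Subject False act]
        by (simp add: Subject False) (simp add: processed_def Subject)
    qed
  qed
  then show "wf_config net ?C R ?cf'" "\<exists>qs. processed ?cf' = processed cf @ qs" by auto
qed

lemma wf_config_at:
  assumes "network_ok net"
  shows "wf_config net (dpml_controller d M) R (config_at net (dpml_controller d M) E Y R rE rY n)"
proof (induction n)
  case 0
  then show ?case by (simp add: config_at_def initial_def wf_config_def processed_def)
next
  case (Suc n)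
  then show ?case using wf_config_step(1)[OF assms] by (simp add: config_at_def)
qed

text \<open>
  Before the tick all answers of the controller are bottom, so that the rest of the execution does not
  depend on its tape; after the tick it depends only on the published output.
\<close>

definition coupled :: "(('p, 'o) dpml_state, 'x, 'o) config \<Rightarrow> (('p, 'o) dpml_state, 'x, 'o) config \<Rightarrow> bool" where
  "coupled cf1 cf2 \<longleftrightarrow>
     (cf2 = cf1\<lparr>st_C := st_C cf2, tape_C := tape_C cf2\<rparr> \<and>
        (st_C cf1 = st_C cf2 \<or> (\<exists>p1 p2. st_C cf1 = Collecting p1 \<and> st_C cf2 = Collecting p2))) \<or>
     (\<exists>qs0 c qs1 qs2 m1 m2. processed cf1 = qs0 @ (c, Tick) # qs1 \<and> processed cf2 = qs0 @ (c, Tick) # qs2 \<and>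
        st_C cf1 = Published m1 \<and> st_C cf2 = Published m2 \<and> m1 \<noteq> m2)"

lemma dispatch_st_C [simp]: "st_C (dispatch net p out cf) = st_C cf"
  by (cases out) (auto split: option.split)

lemma dispatch_update:
  "dispatch net p out (cf\<lparr>st_C := s, tape_C := r\<rparr>) = (dispatch net p out cf)\<lparr>st_C := s, tape_C := r\<rparr>"
  by (cases out) (auto split: option.split)

lemma step_Published:
  assumes "wf_config net (dpml_controller d M) R cf" "st_C cf = Published m"
  shows "st_C (step net (dpml_controller d M) E Y cf) = Published m"
proof (cases "turn cf = Controller")
  case True
  then obtain c m' where "inbox cf = Recv c m'" "\<not> ended cf"
    using assms(1) by (auto simp: wf_config_def)
  then show ?thesis using True assms(2) by (simp add: step_def del: dispatch.simps)
next
  case False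
  then show ?thesis using assms(2) by (cases "turn cf") (auto simp: step_def split: prod.split)
qed

text \<open>In lockstep, the other parties see identical inputs, and only the controller's answer to
  the tick can separate the executions. After separation the second alternative of
  \<open>coupled\<close> is preserved for good.\<close>

lemma coupled_step:
  assumes net: "network_ok net"
    and wf: "wf_config net (dpml_controller d M) R1 cf1" "wf_config net (dpml_controller d M) R2 cf2"
    and coupled: "coupled cf1 cf2"
  shows "coupled (step net (dpml_controller d M) E Y cf1) (step net (dpml_controller d M) E Y cf2)"
    (is "coupled ?cf1 ?cf2")
proof (cases "cf2 = cf1\<lparr>st_C := st_C cf2, tape_C := tape_C cf2\<rparr> \<and>
    (st_C cf1 = st_C cf2 \<or> (\<exists>p1 p2. st_C cf1 = Collecting p1 \<and> st_C cf2 = Collecting p2))")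
  case False
  then obtain qs0 c qs1 qs2 m1 m2 where B: "processed cf1 = qs0 @ (c, Tick) # qs1"
    "processed cf2 = qs0 @ (c, Tick) # qs2" "st_C cf1 = Published m1" "st_C cf2 = Published m2" "m1 \<noteq> m2"
    using coupled by (auto simp: coupled_def)
  \<comment> \<open>Processed lists only grow and published outputs never change.\<close>
  obtain qs1' qs2' where "processed ?cf1 = processed cf1 @ qs1'" "processed ?cf2 = processed cf2 @ qs2'"
    using wf_config_step(2)[OF net wf(1)] wf_config_step(2)[OF net wf(2)] by metis
  then show ?thesis
    using B step_Published[OF wf(1) B(3)] step_Published[OF wf(2) B(4)] by (auto simp: coupled_def)
next
  case True
  obtain s2 r2 where cf2: "cf2 = cf1\<lparr>st_C := s2, tape_C := r2\<rparr>" using True by blast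
  have st: "st_C cf1 = s2 \<or> (\<exists>p1 p2. st_C cf1 = Collecting p1 \<and> s2 = Collecting p2)"
    using True by (simp add: cf2)
  let ?C = "dpml_controller d M"
  show ?thesis
  proof (cases "ended cf1")
    case True
    then show ?thesis using coupled by (simp add: step_ended cf2)
  next
    case False
    then have False2: "\<not> ended cf2" by (simp add: cf2)
    show ?thesis
    proof (cases "turn cf1")
      case Environment
      obtain s out r where act: "run (act E (st_E cf1) (inbox cf1)) (tape_E cf1) = ((s, out), r)"
        by (metis surj_pair)
      \<comment> \<open>The environment sees neither tape of the controller, so its step commutes
        with replacing both; likewise for the subject below.\<close>
      have "?cf2 = dispatch net Environment out ((cf1\<lparr>st_E := s, tape_E := r\<rparr>)\<lparr>st_C := s2, tape_C := r2\<rparr>)"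
      proof -
        have "cf2\<lparr>st_E := s, tape_E := r\<rparr> = cf1\<lparr>st_E := s, tape_E := r\<rparr>\<lparr>st_C := s2, tape_C := r2\<rparr>"
          unfolding cf2 by (cases cf1) simp
        moreover have "?cf2 = dispatch net Environment out (cf2\<lparr>st_E := s, tape_E := r\<rparr>)"
          using Environment False2 act by (intro step_Environment) (simp_all add: cf2)
        ultimately show ?thesis by (simp only:)
      qed
      then have "?cf2 = ?cf1\<lparr>st_C := s2, tape_C := r2\<rparr>"
        unfolding dispatch_update step_Environment[OF Environment False act] .
      moreover have "st_C ?cf1 = st_C cf1"
        by (simp add: step_Environment[OF Environment False act])
      ultimately show ?thesis using st by (simp add: coupled_def)
    next
      case Subject
      obtain s out r where act: "run (act Y (st_Y cf1) (inbox cf1)) (tape_Y cf1) = ((s, out), r)"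
        by (metis surj_pair)
      have "?cf2 = dispatch net Subject out ((cf1\<lparr>st_Y := s, tape_Y := r\<rparr>)\<lparr>st_C := s2, tape_C := r2\<rparr>)"
      proof -
        have "cf2\<lparr>st_Y := s, tape_Y := r\<rparr> = cf1\<lparr>st_Y := s, tape_Y := r\<rparr>\<lparr>st_C := s2, tape_C := r2\<rparr>"
          unfolding cf2 by (cases cf1) simp
        moreover have "?cf2 = dispatch net Subject out (cf2\<lparr>st_Y := s, tape_Y := r\<rparr>)"
          using Subject False2 act by (intro step_Subject) (simp_all add: cf2)
        ultimately show ?thesis by (simp only:)
      qed
      then have "?cf2 = ?cf1\<lparr>st_C := s2, tape_C := r2\<rparr>"
        unfolding dispatch_update step_Subject[OF Subject False act] .
      moreover have "st_C ?cf1 = st_C cf1"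
        by (simp add: step_Subject[OF Subject False act])
      ultimately show ?thesis using st by (simp add: coupled_def)
    next
      case Controller
      then obtain c m where cm: "inbox cf1 = Recv c m" "queries (trace cf1) = processed cf1 @ [(c, m)]"
        using wf(1) by (auto simp: wf_config_def)
      obtain s1' out1 r1' where act1: "run (act ?C (st_C cf1) (inbox cf1)) (tape_C cf1) = ((s1', out1), r1')"
        by (metis surj_pair)
      obtain s2' out2 r2' where act2: "run (act ?C (st_C cf2) (inbox cf2)) (tape_C cf2) = ((s2', out2), r2')"
        by (metis surj_pair)
      have mem: "(s1', out1) \<in> set_rand (dpml_act d M (st_C cf1) (Recv c m))"
        "(s2', out2) \<in> set_rand (dpml_act d M s2 (Recv c m))"
        using fst_run_in_set_rand[of "act ?C (st_C cf1) (inbox cf1)" "tape_C cf1"] act1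
          fst_run_in_set_rand[of "act ?C (st_C cf2) (inbox cf2)" "tape_C cf2"] act2
        by (simp_all add: cm(1) cf2)
      have turn2: "turn cf2 = Controller" using Controller by (simp add: cf2)
      note step1 = step_Controller[OF Controller False act1]
        and step2 = step_Controller[OF turn2 False2 act2]
      have st': "st_C ?cf1 = s1'" "st_C ?cf2 = s2'" by (simp_all add: step1 step2)
      \<comment> \<open>Equal answers keep the executions in lockstep, even if the physical states
        of the dictionaries differ.\<close>
      have same_out: ?thesis
        if "out1 = out2" "s1' = s2' \<or> (\<exists>p1 p2. s1' = Collecting p1 \<and> s2' = Collecting p2)"
      proof -
        have "?cf2 = dispatch net Controller out1
            ((cf1\<lparr>st_C := s1', tape_C := r1', ended := (inbox cf1 = Recv (subj_cid net) Delete)\<rparr>)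
              \<lparr>st_C := s2', tape_C := r2'\<rparr>)"
          unfolding step2 that(1) unfolding cf2 by (cases cf1) simp
        then have "?cf2 = ?cf1\<lparr>st_C := s2', tape_C := r2'\<rparr>" unfolding dispatch_update step1 .
        then show ?thesis using that(2) st' by (simp add: coupled_def)
      qed
      show ?thesis
      proof (cases "\<exists>p1 p2. st_C cf1 = Collecting p1 \<and> s2 = Collecting p2")
        case False
        then have eq: "st_C cf1 = s2" using st by blast
        then obtain v where v: "s2 = Published v" using False by (cases s2) blast+
        have "s1' = Published v" "out1 = Some (c, Reply (Some v))"
          "s2' = Published v" "out2 = Some (c, Reply (Some v))"
          using mem unfolding eq v by simp_all
        then show ?thesis by (intro same_out) simp_all
      next
        case True
        then obtain p1 p2 where p: "st_C cf1 = Collecting p1" "s2 = Collecting p2" by blast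
        show ?thesis
        proof (cases "m = Tick")
          case False
          then show ?thesis
            using dpml_act_Collecting[OF False mem(1)[unfolded p]]
              dpml_act_Collecting[OF False mem(2)[unfolded p]] by (intro same_out) auto
        next
          case True
          \<comment> \<open>The only branching point: the two runs of \<open>M\<close> may publish
            different values, and then the tick being processed, preceded by the same queries,
            witnesses the second alternative of \<open>coupled\<close>.\<close>
          obtain v1 v2 where v: "s1' = Published v1" "out1 = Some (c, Reply (Some v1))"
            "s2' = Published v2" "out2 = Some (c, Reply (Some v2))"
            using dpml_act_Tick[OF mem(1)[unfolded p True]] dpml_act_Tick[OF mem(2)[unfolded p True]] by auto
          show ?thesis
          proof (cases "v1 = v2")
            case True
            then show ?thesis using v by (intro same_out) simp_all
          next
            case False
            have "processed cf2 = processed cf1" "inbox cf2 = Recv c m"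
              by (simp_all add: cf2 processed_def cm(1))
            then have "processed ?cf1 = processed cf1 @ [(c, Tick)]" "processed ?cf2 = processed cf1 @ [(c, Tick)]"
              using step_Controller_wf(2)[OF net wf(1) Controller cm(1)]
                step_Controller_wf(2)[OF net wf(2) turn2] True by simp_all
            then show ?thesis unfolding coupled_def st' v using False by blast
          qed
        qed
      qed
    qed
  qed
qed

lemma coupled_at:
  assumes "network_ok net"
  shows "coupled (config_at net (dpml_controller d M) E Y R1 rE rY n)
    (config_at net (dpml_controller d M) E Y R2 rE rY n)"
proof (induction n)
  case 0
  have "\<exists>p. fst (run (start (dpml_controller d M)) R) = Collecting p" for R
    using fst_run_in_set_rand[of "start (dpml_controller d M)" R] by (auto simp: set_bind_rand)
  then show ?case by (simp add: config_at_def initial_def coupled_def)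
next
  case (Suc n)
  then show ?case
    using coupled_step[OF assms wf_config_at[OF assms] wf_config_at[OF assms]] by (simp add: config_at_def)
qed

section \<open>Comparing completed executions\<close>

lemma real_exec_ended:
  assumes "ended (config_at net C E Y R rE rY n)"
  shows "real_exec net C E Y R rE rY =
    (trace (config_at net C E Y R rE rY n), Some (st_C (config_at net C E Y R rE rY n)))"
proof -
  have "config_at net C E Y R rE rY (LEAST n. ended (config_at net C E Y R rE rY n)) =
      config_at net C E Y R rE rY n"
    using assms unfolding config_at_def by (rule funpow_Least) (rule step_ended)
  moreover have "ends net C E Y R rE rY" using assms by (auto simp: ends_def)
  ultimately show ?thesis by (simp add: real_exec_def Let_def)
qed

lemma ended_mono:
  assumes "ended (config_at net C E Y R rE rY m)" "m \<le> n"
  shows "ended (config_at net C E Y R rE rY n)"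
proof -
  have "config_at net C E Y R rE rY n = config_at net C E Y R rE rY m"
    using assms(1) unfolding config_at_def
    by (rule funpow_stable[where P = ended]) (simp_all add: step_ended assms(2))
  then show ?thesis using assms(1) by simp
qed

lemma real_exec_final:
  assumes net: "network_ok net" and ends: "ends net (dpml_controller d M) E Y R rE rY"
  obtains \<tau> s qs where "real_exec net (dpml_controller d M) E Y R rE rY = (\<tau>, Some s)"
    "admissible net \<tau>" "s = fst (run (session (dpml_controller d M) (queries \<tau>)) R)"
    "queries \<tau> = qs @ [(subj_cid net, Delete)]"
proof -
  obtain n where n: "ended (config_at net (dpml_controller d M) E Y R rE rY n)"
    using ends by (auto simp: ends_def)
  have wf: "wf_config net (dpml_controller d M) R (config_at net (dpml_controller d M) E Y R rE rY n)"
    by (rule wf_config_at[OF net])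
  then have "turn (config_at net (dpml_controller d M) E Y R rE rY n) \<noteq> Controller"
    using n by (auto simp: wf_config_def)
  moreover obtain qs where "queries (trace (config_at net (dpml_controller d M) E Y R rE rY n)) =
      qs @ [(subj_cid net, Delete)]"
    using wf n by (auto simp: wf_config_def)
  ultimately show ?thesis
    using wf by (intro that[OF real_exec_ended[OF n]]) (simp_all add: wf_config_def processed_eq_queries)
qed

text \<open>For fixed tapes of the environment and the subject, the real and the ideal program are
  thus the same for all controller tapes on which the execution ends. The final state moreover
  determines the environment's queries, hence also the prefix length that the simulator
  uses.\<close>

lemma real_exec_coupling:
  assumes net: "network_ok net"
    and ends: "ends net (dpml_controller d M) E Y R1 rE rY" "ends net (dpml_controller d M) E Y R2 rE rY"
    and exec: "real_exec net (dpml_controller d M) E Y R1 rE rY = (\<tau>1, Some s1)"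
      "real_exec net (dpml_controller d M) E Y R2 rE rY = (\<tau>2, Some s2)"
  shows "session (dpml_controller d M) (queries \<tau>1) = session (dpml_controller d M) (queries \<tau>2)"
    and "session (dpml_controller d M) (env_queries \<tau>1) = session (dpml_controller d M) (env_queries \<tau>2)"
    and "s1 = s2 \<Longrightarrow> env_queries \<tau>1 = env_queries \<tau>2"
proof -
  let ?C = "dpml_controller d M"
  obtain n1 n2 where "ended (config_at net ?C E Y R1 rE rY n1)" "ended (config_at net ?C E Y R2 rE rY n2)"
    using ends by (auto simp: ends_def)
  \<comment> \<open>The executions may end at different times; they are compared at the later one,
    as ended configurations no longer move.\<close>
  then have n: "ended (config_at net ?C E Y R1 rE rY (max n1 n2))"
    "ended (config_at net ?C E Y R2 rE rY (max n1 n2))"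
    by (auto intro: ended_mono)
  define cf1 where "cf1 = config_at net ?C E Y R1 rE rY (max n1 n2)"
  define cf2 where "cf2 = config_at net ?C E Y R2 rE rY (max n1 n2)"
  have tr: "\<tau>1 = trace cf1" "s1 = st_C cf1" "\<tau>2 = trace cf2" "s2 = st_C cf2"
    using real_exec_ended[OF n(1)] real_exec_ended[OF n(2)] exec by (simp_all add: cf1_def cf2_def)
  have wf: "wf_config net ?C R1 cf1" "wf_config net ?C R2 cf2"
    unfolding cf1_def cf2_def by (rule wf_config_at[OF net])+
  then have pr: "processed cf1 = queries \<tau>1" "processed cf2 = queries \<tau>2"
    using n by (auto simp: wf_config_def cf1_def cf2_def tr intro!: processed_eq_queries)
  have adm: "admissible net \<tau>1" "admissible net \<tau>2"
    using wf by (simp_all add: wf_config_def tr)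
  have "coupled cf1 cf2" unfolding cf1_def cf2_def by (rule coupled_at[OF net])
  then consider (same) "cf2 = cf1\<lparr>st_C := st_C cf2, tape_C := tape_C cf2\<rparr>"
    | (tick) qs0 c qs1 qs2 m1 m2 where "queries \<tau>1 = qs0 @ (c, Tick) # qs1" "queries \<tau>2 = qs0 @ (c, Tick) # qs2"
        "s1 = Published m1" "s2 = Published m2" "m1 \<noteq> m2"
    unfolding coupled_def pr tr(2,4)[symmetric] by blast
  then have "session ?C (queries \<tau>1) = session ?C (queries \<tau>2) \<and>
      session ?C (env_queries \<tau>1) = session ?C (env_queries \<tau>2) \<and>
      (s1 = s2 \<longrightarrow> env_queries \<tau>1 = env_queries \<tau>2)"
  proof cases
    case same
    have "trace cf2 = trace cf1" using arg_cong[OF same, of config.trace] by simp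
    then show ?thesis by (simp add: tr)
  next
    case tick
    have "c \<noteq> subj_cid net" using env_queries_admissible(4)[OF net adm(1)] tick(1) by auto
    then have env: "env_queries \<tau>1 = filter (\<lambda>(c, m). c \<noteq> subj_cid net) qs0 @
          (c, Tick) # filter (\<lambda>(c, m). c \<noteq> subj_cid net) qs1"
        "env_queries \<tau>2 = filter (\<lambda>(c, m). c \<noteq> subj_cid net) qs0 @
          (c, Tick) # filter (\<lambda>(c, m). c \<noteq> subj_cid net) qs2"
      using env_queries_admissible(1)[OF net adm(1)] env_queries_admissible(1)[OF net adm(2)] tick(1,2)
      by simp_all
    \<comment> \<open>The lists may differ only behind the tick, where \<open>session\<close>
      ignores them.\<close>
    have "session ?C (qs @ (c, Tick) # qs1') = session ?C (qs @ (c, Tick) # qs2')" for qs qs1' qs2'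
      by (rule trans[OF session_Tick session_Tick[symmetric]])
    then show ?thesis using tick(5) unfolding env tick(1-4) by blast
  qed
  then show "session ?C (queries \<tau>1) = session ?C (queries \<tau>2)"
    "session ?C (env_queries \<tau>1) = session ?C (env_queries \<tau>2)"
    "s1 = s2 \<Longrightarrow> env_queries \<tau>1 = env_queries \<tau>2"
    by blast+
qed

section \<open>Measurability of the real execution\<close>

instance msg :: (countable, countable) countable by countable_datatype
instance input :: (countable) countable by countable_datatype
instance party :: countable by countable_datatype

text \<open>A configuration splits into data treated as discrete and three random tapes;
  measurability is stated for the two parts separately, as the record type carries no measurable
  structure.\<close>

definition discrete_part :: "('s, 'x, 'o) config \<Rightarrow>
    's \<times> bool list \<times> bool list \<times> party \<times> ('x, 'o) msg input \<times> ('x, 'o) transcript \<times> bool" where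
  "discrete_part cf = (st_C cf, st_E cf, st_Y cf, turn cf, inbox cf, config.trace cf, ended cf)"

definition tapes :: "('s, 'x, 'o) config \<Rightarrow> bool stream \<times> bool stream \<times> bool stream" where
  "tapes cf = (tape_C cf, tape_E cf, tape_Y cf)"

fun make_config :: "'s \<times> bool list \<times> bool list \<times> party \<times> ('x, 'o) msg input \<times> ('x, 'o) transcript \<times> bool \<Rightarrow>
    bool stream \<times> bool stream \<times> bool stream \<Rightarrow> ('s, 'x, 'o) config" where
  "make_config (sC, sE, sY, t, i, tr, e) (rC, rE, rY) =
     \<lparr>st_C = sC, st_E = sE, st_Y = sY, tape_C = rC, tape_E = rE, tape_Y = rY,
      turn = t, inbox = i, trace = tr, ended = e\<rparr>"

lemma make_config_eq: "make_config (discrete_part cf) (tapes cf) = cf"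
  by (simp add: discrete_part_def tapes_def)

lemma discrete_make_config [simp]: "discrete_part (make_config x T) = x"
  and tapes_make_config [simp]: "tapes (make_config x T) = T"
  by (cases x; cases T; simp add: discrete_part_def tapes_def)+

lemma tapes_dispatch [simp]: "tapes (dispatch net p out cf) = tapes cf"
  by (cases out) (auto simp: tapes_def split: option.split)

lemma discrete_dispatch:
  "discrete_part cf = discrete_part cf' \<Longrightarrow> discrete_part (dispatch net p out cf) = discrete_part (dispatch net p out cf')"
proof (cases out)
  case (Some q)
  obtain c m where "q = (c, m)" by (cases q)
  moreover assume "discrete_part cf = discrete_part cf'"
  ultimately show ?thesis using Some by (cases "route net p c m") (auto simp: discrete_part_def)
qed (auto simp: discrete_part_def)

lemma measurable_discrete_dispatch:
  assumes f: "f \<in> N \<rightarrow>\<^sub>M count_space UNIV"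
    and F: "\<And>\<omega>. discrete_part (F \<omega>) = K (f \<omega>)"
  shows "(\<lambda>\<omega>. discrete_part (dispatch net p (snd (f \<omega>)) (F \<omega>))) \<in> N \<rightarrow>\<^sub>M count_space UNIV"
proof -
  \<comment> \<open>The discrete part of the result ignores the tapes, so \<open>undefined\<close>
    can stand in for them, leaving a function of \<open>f \<omega>\<close> alone.\<close>
  have "(\<lambda>\<omega>. discrete_part (dispatch net p (snd (f \<omega>)) (F \<omega>))) =
      (\<lambda>\<omega>. (\<lambda>y. discrete_part (dispatch net p (snd y) (make_config (K y) undefined))) (f \<omega>))"
    by (intro ext discrete_dispatch) (simp add: F)
  also have "\<dots> \<in> N \<rightarrow>\<^sub>M count_space UNIV"
    by (rule measurable_compose[OF f]) simp
  finally show ?thesis .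
qed

definition config_measurable :: "'w measure \<Rightarrow> ('w \<Rightarrow> ('s, 'x, 'o) config) \<Rightarrow> bool" where
  "config_measurable N F \<longleftrightarrow> (\<lambda>\<omega>. discrete_part (F \<omega>)) \<in> N \<rightarrow>\<^sub>M count_space UNIV \<and>
     (\<lambda>\<omega>. tapes (F \<omega>)) \<in> N \<rightarrow>\<^sub>M coins \<Otimes>\<^sub>M coins \<Otimes>\<^sub>M coins"

text \<open>With the discrete part fixed, it is known which party moves and on which input, so a
  step is a single program run on one of the tapes.\<close>

lemma config_measurable_step_fixed:
  assumes [measurable]: "T \<in> N \<rightarrow>\<^sub>M coins \<Otimes>\<^sub>M coins \<Otimes>\<^sub>M coins"
  shows "config_measurable N (\<lambda>\<omega>. step net C E Y (make_config x (T \<omega>)))"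
proof -
  obtain sC sE sY t i tr e where x: "x = (sC, sE, sY, t, i, tr, e)" by (metis surj_pair)
  define RC where "RC \<omega> = fst (T \<omega>)" for \<omega>
  define RE where "RE \<omega> = fst (snd (T \<omega>))" for \<omega>
  define RY where "RY \<omega> = snd (snd (T \<omega>))" for \<omega>
  have [measurable]: "RC \<in> N \<rightarrow>\<^sub>M coins" "RE \<in> N \<rightarrow>\<^sub>M coins" "RY \<in> N \<rightarrow>\<^sub>M coins"
    unfolding RC_def RE_def RY_def by measurable
  have T: "T \<omega> = (RC \<omega>, RE \<omega>, RY \<omega>)" for \<omega> by (simp add: RC_def RE_def RY_def)
  show ?thesis
  proof (cases "e")
    case True
    then have "step net C E Y (make_config x (T \<omega>)) = make_config x (T \<omega>)" for \<omega>
      by (intro step_ended) (simp add: x T)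
    then show ?thesis by (simp add: config_measurable_def assms)
  next
    case e: False
    show ?thesis
    proof (cases t)
      case Controller
      have "step net C E Y (make_config x (T \<omega>)) =
          dispatch net Controller (snd (fst (run (act C sC i) (RC \<omega>))))
            (make_config (fst (fst (run (act C sC i) (RC \<omega>))), sE, sY, t, i, tr, i = Recv (subj_cid net) Delete)
               (snd (run (act C sC i) (RC \<omega>)), RE \<omega>, RY \<omega>))" for \<omega>
        using e by (simp add: x T Controller step_def case_prod_beta del: dispatch.simps)
      then show ?thesis
        unfolding config_measurable_def
        by (auto simp del: make_config.simps intro!: measurable_discrete_dispatch
            [where K = "\<lambda>y. (fst y, sE, sY, t, i, tr, i = Recv (subj_cid net) Delete)"])
    next
      case Environment
      have "step net C E Y (make_config x (T \<omega>)) =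
          dispatch net Environment (snd (fst (run (act E sE i) (RE \<omega>))))
            (make_config (sC, fst (fst (run (act E sE i) (RE \<omega>))), sY, t, i, tr, e)
               (RC \<omega>, snd (run (act E sE i) (RE \<omega>)), RY \<omega>))" for \<omega>
        using e by (simp add: x T Environment step_def case_prod_beta del: dispatch.simps)
      then show ?thesis
        unfolding config_measurable_def
        by (auto simp del: make_config.simps intro!: measurable_discrete_dispatch
            [where K = "\<lambda>y. (sC, fst y, sY, t, i, tr, e)"])
    next
      case Subject
      have "step net C E Y (make_config x (T \<omega>)) =
          dispatch net Subject (snd (fst (run (act Y sY i) (RY \<omega>))))
            (make_config (sC, sE, fst (fst (run (act Y sY i) (RY \<omega>))), t, i, tr, e)
               (RC \<omega>, RE \<omega>, snd (run (act Y sY i) (RY \<omega>))))" for \<omega>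
        using e by (simp add: x T Subject step_def case_prod_beta del: dispatch.simps)
      then show ?thesis
        unfolding config_measurable_def
        by (auto simp del: make_config.simps intro!: measurable_discrete_dispatch
            [where K = "\<lambda>y. (sC, sE, fst y, t, i, tr, e)"])
    qed
  qed
qed

text \<open>There are only countably many discrete parts, so measurability for each fixed one
  suffices.\<close>

lemma config_measurable_step:
  fixes F :: "'w \<Rightarrow> ('s::countable, 'x::countable, 'o::countable) config"
  assumes "config_measurable N F"
  shows "config_measurable N (\<lambda>\<omega>. step net C E Y (F \<omega>))"
proof -
  have d: "(\<lambda>\<omega>. discrete_part (F \<omega>)) \<in> N \<rightarrow>\<^sub>M count_space UNIV"
    and t: "(\<lambda>\<omega>. tapes (F \<omega>)) \<in> N \<rightarrow>\<^sub>M coins \<Otimes>\<^sub>M coins \<Otimes>\<^sub>M coins"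
    using assms by (simp_all add: config_measurable_def)
  note fixed = config_measurable_step_fixed[OF t, of net C E Y, unfolded config_measurable_def]
  have "(\<lambda>\<omega>. discrete_part (step net C E Y (make_config (discrete_part (F \<omega>)) (tapes (F \<omega>))))) \<in> N \<rightarrow>\<^sub>M count_space UNIV"
    by (rule measurable_compose_countable[OF _ d]) (use fixed in blast)
  moreover have "(\<lambda>\<omega>. tapes (step net C E Y (make_config (discrete_part (F \<omega>)) (tapes (F \<omega>)))))
      \<in> N \<rightarrow>\<^sub>M coins \<Otimes>\<^sub>M coins \<Otimes>\<^sub>M coins"
    by (rule measurable_compose_countable[OF _ d]) (use fixed in blast)
  ultimately show ?thesis by (simp add: make_config_eq config_measurable_def)
qed

lemma config_measurable_config_at:
  fixes C :: "('s::countable, ('x::countable, 'o::countable) msg) machine"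
  assumes [measurable]: "R \<in> N \<rightarrow>\<^sub>M coins" "rE \<in> N \<rightarrow>\<^sub>M coins" "rY \<in> N \<rightarrow>\<^sub>M coins"
  shows "config_measurable N (\<lambda>\<omega>. config_at net C E Y (R \<omega>) (rE \<omega>) (rY \<omega>) n)"
proof (induction n)
  case 0
  have "(\<lambda>\<omega>. discrete_part (initial C E Y (R \<omega>) (rE \<omega>) (rY \<omega>))) \<in> N \<rightarrow>\<^sub>M count_space UNIV"
  proof -
    have "(\<lambda>\<omega>. (fst (run (start C) (R \<omega>)), fst (run (start E) (rE \<omega>)), fst (run (start Y) (rY \<omega>))))
        \<in> N \<rightarrow>\<^sub>M count_space UNIV" by measurable
    from measurable_compose[OF this, of "\<lambda>(a, b, c). (a, b, c, Environment, Wake, [], False)" "count_space UNIV"]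
    show ?thesis by (simp add: initial_def discrete_part_def)
  qed
  moreover have "(\<lambda>\<omega>. tapes (initial C E Y (R \<omega>) (rE \<omega>) (rY \<omega>))) \<in> N \<rightarrow>\<^sub>M coins \<Otimes>\<^sub>M coins \<Otimes>\<^sub>M coins"
    by (simp add: initial_def tapes_def)
  ultimately show ?case by (simp add: config_at_def config_measurable_def)
next
  case (Suc n)
  from config_measurable_step[OF this] show ?case by (simp add: config_at_def)
qed

lemma measurable_real_exec:
  fixes C :: "('s::countable, ('x::countable, 'o::countable) msg) machine"
  assumes R: "R \<in> N \<rightarrow>\<^sub>M coins" "rE \<in> N \<rightarrow>\<^sub>M coins" "rY \<in> N \<rightarrow>\<^sub>M coins"
  shows "(\<lambda>\<omega>. real_exec net C E Y (R \<omega>) (rE \<omega>) (rY \<omega>)) \<in> N \<rightarrow>\<^sub>M count_space UNIV"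
proof -
  let ?cf = "\<lambda>n \<omega>. config_at net C E Y (R \<omega>) (rE \<omega>) (rY \<omega>) n"
  have d: "(\<lambda>\<omega>. discrete_part (?cf n \<omega>)) \<in> N \<rightarrow>\<^sub>M count_space UNIV" for n
    by (rule config_measurable_config_at[OF R, unfolded config_measurable_def, THEN conjunct1])
  have [measurable]: "Measurable.pred N (\<lambda>\<omega>. ended (?cf n \<omega>))" for n
    using measurable_compose[OF d, of "\<lambda>(a, b, c, t, i, tr, e). e" "count_space UNIV" n]
    by (simp add: discrete_part_def)
  have out: "(\<lambda>\<omega>. (config.trace (?cf n \<omega>), Some (st_C (?cf n \<omega>)))) \<in> N \<rightarrow>\<^sub>M count_space UNIV" for n
    using measurable_compose[OF d, of "\<lambda>(a, b, c, t, i, tr, e). (tr, Some a)" "count_space UNIV" n]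
    by (simp add: discrete_part_def)
  have [measurable]: "(\<lambda>\<omega>. let cf = ?cf (LEAST n. ended (?cf n \<omega>)) \<omega> in (config.trace cf, Some (st_C cf)))
      \<in> N \<rightarrow>\<^sub>M count_space UNIV"
    unfolding Let_def by (rule measurable_compose_countable[OF out]) measurable
  show ?thesis unfolding real_exec_def ends_def by measurable
qed

section \<open>The simulator\<close>

text \<open>One prefix length for all ways in which a subject may interleave its queries, so it can
  be found from the environment's queries alone.\<close>

definition coin_bound :: "('s, ('x, 'o) msg) machine \<Rightarrow> ('x, 'o) query list \<Rightarrow> nat" where
  "coin_bound C q = (SOME N. \<forall>y qs. filter (\<lambda>(c, m). c \<noteq> y) qs = q \<longrightarrow> (y, Tick) \<notin> set qs \<longrightarrow>
     depth (session C qs) \<le> N)"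

lemma depth_le_coin_bound:
  assumes "coin_bounded C" "(y, Tick) \<notin> set qs"
  shows "depth (session C qs) \<le> coin_bound C (filter (\<lambda>(c, m). c \<noteq> y) qs)"
proof -
  have "\<exists>N. \<forall>y qs'. filter (\<lambda>(c, m). c \<noteq> y) qs' = q \<longrightarrow> (y, Tick) \<notin> set qs' \<longrightarrow>
      depth (session C qs') \<le> N" for q
    using assms(1) unfolding coin_bounded_def session_def by blast
  from someI_ex[OF this] show ?thesis using assms(2) unfolding coin_bound_def by blast
qed

text \<open>For the DP learning controller, \<open>session C q\<close> computes the final state of
  the ideal execution. The tape stays unchanged if there is no final state to match, or if no tape
  leads \<open>session C q\<close> to that state.\<close>

definition conditional_sim :: "('s, ('x, 'o) msg) machine \<Rightarrow> ('s, 'x, 'o) simulator" where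
  "conditional_sim C q R st r =
     (case st of None \<Rightarrow> []
      | Some s \<Rightarrow> if s \<in> set_rand (session C q)
          then resample (coin_bound C q) (\<lambda>R. fst (run (session C q) R) = s) r else [])"

lemma measurable_conditional_sim:
  assumes [measurable]: "X \<in> N \<rightarrow>\<^sub>M coins"
  shows "(\<lambda>\<omega>. conditional_sim C q (R \<omega>) st (X \<omega>)) \<in> N \<rightarrow>\<^sub>M count_space UNIV"
proof (cases st)
  case (Some s)
  have "(\<lambda>\<omega>. resample (coin_bound C q) (\<lambda>R. fst (run (session C q) R) = s) (X \<omega>))
      \<in> N \<rightarrow>\<^sub>M count_space UNIV"
    by measurable
  then show ?thesis using Some by (simp add: conditional_sim_def)
qed (simp add: conditional_sim_def)

lemma overwrite_Nil [simp]: "overwrite [] R = R"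
  by (simp add: overwrite_def)

lemma env_queries_real_exec:
  assumes "network_ok net"
  shows "fst ` set (env_queries (fst (real_exec net (dpml_controller d M) E Y R rE rY))) \<subseteq> env_cids net"
proof (cases "ends net (dpml_controller d M) E Y R rE rY")
  case True
  from real_exec_final[OF assms this] obtain \<tau> s
    where "real_exec net (dpml_controller d M) E Y R rE rY = (\<tau>, Some s)" "admissible net \<tau>" by metis
  then show ?thesis using env_queries_admissible(2)[OF assms] by simp
qed (simp add: real_exec_def env_queries_def)

definition sim_tape :: "network \<Rightarrow> ('s, ('x, 'o) msg) machine \<Rightarrow> ('x, 'o) outside_party \<Rightarrow> ('x, 'o) outside_party \<Rightarrow>
    bool stream \<Rightarrow> bool stream \<Rightarrow> bool stream \<Rightarrow> bool stream \<Rightarrow> bool stream" where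
  "sim_tape net C E Y R rE rY r = (let (\<tau>, st) = real_exec net C E Y R rE rY in
     overwrite (conditional_sim C (env_queries \<tau>) R st r) R)"

text \<open>The event in the second condition of deletion-as-control.\<close>

definition faithful :: "network \<Rightarrow> ('s, ('x, 'o) msg) machine \<Rightarrow> ('x, 'o) outside_party \<Rightarrow> ('x, 'o) outside_party \<Rightarrow>
    bool stream \<Rightarrow> bool stream \<Rightarrow> bool stream \<Rightarrow> bool stream \<Rightarrow> bool" where
  "faithful net C E Y R rE rY r \<longleftrightarrow> (let (\<tau>, st) = real_exec net C E Y R rE rY in
     ideal_exec net C (env_queries \<tau>) (sim_tape net C E Y R rE rY r) = st \<or> st = None)"

lemma measurable_sim_tape [measurable (raw)]:
  fixes C :: "('s::countable, ('x::countable, 'o::countable) msg) machine"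
  assumes [measurable]: "R \<in> N \<rightarrow>\<^sub>M coins" "rE \<in> N \<rightarrow>\<^sub>M coins" "rY \<in> N \<rightarrow>\<^sub>M coins" "r \<in> N \<rightarrow>\<^sub>M coins"
  shows "(\<lambda>\<omega>. sim_tape net C E Y (R \<omega>) (rE \<omega>) (rY \<omega>) (r \<omega>)) \<in> N \<rightarrow>\<^sub>M coins"
proof -
  have "(\<lambda>\<omega>. (\<lambda>x. overwrite (conditional_sim C (env_queries (fst x)) (R \<omega>) (snd x) (r \<omega>)) (R \<omega>))
      (real_exec net C E Y (R \<omega>) (rE \<omega>) (rY \<omega>))) \<in> N \<rightarrow>\<^sub>M coins"
    by (rule measurable_compose_countable[OF _ measurable_real_exec])
      (intro measurable_overwrite measurable_conditional_sim assms)+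
  then show ?thesis unfolding sim_tape_def by (simp add: case_prod_beta)
qed

lemma measurable_faithful:
  fixes d :: "('p::countable, 'x::countable) dictionary" and M :: "'x dataset \<Rightarrow> ('o::countable) rand"
  assumes net: "network_ok net"
    and [measurable]: "R \<in> N \<rightarrow>\<^sub>M coins" "rE \<in> N \<rightarrow>\<^sub>M coins" "rY \<in> N \<rightarrow>\<^sub>M coins" "r \<in> N \<rightarrow>\<^sub>M coins"
  shows "Measurable.pred N (\<lambda>\<omega>. faithful net (dpml_controller d M) E Y (R \<omega>) (rE \<omega>) (rY \<omega>) (r \<omega>))"
proof -
  let ?C = "dpml_controller d M"
  have "Measurable.pred N (\<lambda>\<omega>. (\<lambda>x.
      Some (fst (run (session ?C (env_queries (fst x))) (sim_tape net ?C E Y (R \<omega>) (rE \<omega>) (rY \<omega>) (r \<omega>)))) = snd x \<or>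
      snd x = None) (real_exec net ?C E Y (R \<omega>) (rE \<omega>) (rY \<omega>)))"
    by (rule measurable_compose_countable[OF _ measurable_real_exec]) measurable
  then show ?thesis
    unfolding faithful_def
    by (simp add: case_prod_beta ideal_exec_dpml[OF env_queries_real_exec[OF net]])
qed

context
  fixes d :: "('p::countable, 'x::countable) dictionary"
    and M :: "'x dataset \<Rightarrow> ('o::countable) rand"
    and \<epsilon> \<delta> :: real and net :: network and E Y :: "('x, 'o) outside_party"
    and C :: "(('p, 'o) dpml_state, ('x, 'o) msg) machine"
  assumes dict: "is_dictionary d" and hi: "strongly_history_independent d"
    and dp: "differentially_private \<epsilon> \<delta> M"
    and bounded: "coin_bounded (dpml_controller d M)"
    and net: "network_ok net"
  defines "C \<equiv> dpml_controller d M"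
begin

text \<open>Here the restriction on endings enters: for fixed tapes of the environment and the
  subject, almost all controller tapes fall under the same case, so a single pair of programs
  describes the real and the ideal final state.\<close>

lemma sim_tape_eq_resimulate:
  assumes "(AE R in coins. ends net C E Y R rE rY) \<or> (AE R in coins. \<not> ends net C E Y R rE rY)"
  obtains p I :: "('p, 'o) dpml_state rand" and N
  where "indist \<epsilon> \<delta> (law p) (law I)"
    and "\<And>s. s \<in> set_rand p \<Longrightarrow> depth p \<le> N s \<and> depth I \<le> N s"
    and "AE R in coins. \<forall>r. sim_tape net C E Y R rE rY r = resimulate (\<lambda>R. fst (run p R)) I N R r"
    and "AE R in coins. \<forall>r. fst (run I (sim_tape net C E Y R rE rY r)) = fst (run p R) \<longrightarrow> faithful net C E Y R rE rY r"
  using assms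
proof (elim disjE)
  assume never: "AE R in coins. \<not> ends net C E Y R rE rY"
  \<comment> \<open>With probability one there is no final state and the tape is kept. A program
    with a single outcome and prefix length 0 resimulates in the same way.\<close>
  let ?D = "Done undefined :: ('p, 'o) dpml_state rand"
  have "indist \<epsilon> \<delta> (law (M fmempty)) (law (M fmempty))"
    using dp by (simp add: differentially_private_def neighbors_def)
  then have "indist \<epsilon> \<delta> (law ?D) (law ?D)" by (rule indist_refl)
  moreover have "AE R in coins. \<forall>r. sim_tape net C E Y R rE rY r = resimulate (\<lambda>R. fst (run ?D R)) ?D (\<lambda>_. 0) R r"
    using never
  proof eventually_elim
    case (elim R)
    have "resample 0 good r = []" for good r
      by (rule length_0_conv[THEN iffD1, OF length_resample])
    then show ?case using elim by (simp add: sim_tape_def real_exec_def conditional_sim_def resimulate_def)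
  qed
  moreover have "AE R in coins. \<forall>r. fst (run ?D (sim_tape net C E Y R rE rY r)) = fst (run ?D R) \<longrightarrow> faithful net C E Y R rE rY r"
    using never by eventually_elim (simp add: faithful_def real_exec_def)
  ultimately show ?thesis by (intro that[of ?D ?D "\<lambda>_. 0"]) simp_all
next
  assume always: "AE R in coins. ends net C E Y R rE rY"
  \<comment> \<open>A reference tape that fixes the two programs; by
    \<open>real_exec_coupling\<close> every other ending execution gives the same ones.\<close>
  then obtain R0 where R0: "ends net C E Y R0 rE rY"
    using coins.ae_filter_bot eventually_happens'[of "ae_filter coins"] by blast
  obtain \<tau>0 s0 qs where exec0: "real_exec net C E Y R0 rE rY = (\<tau>0, Some s0)" "admissible net \<tau>0"
    "queries \<tau>0 = qs @ [(subj_cid net, Delete)]"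
    using real_exec_final[OF net R0[unfolded C_def]] unfolding C_def by metis
  define p where "p = session C (queries \<tau>0)"
  define I where "I = session C (env_queries \<tau>0)"
  \<comment> \<open>The environment's queries as a function of the final state, well defined by the
    last part of \<open>real_exec_coupling\<close>.\<close>
  define q where "q s = (SOME q. \<exists>R \<tau>. ends net C E Y R rE rY \<and>
    real_exec net C E Y R rE rY = (\<tau>, Some s) \<and> q = env_queries \<tau>)" for s
  have exec: "\<exists>\<tau>. real_exec net C E Y R rE rY = (\<tau>, Some (fst (run p R))) \<and> admissible net \<tau> \<and>
      session C (queries \<tau>) = p \<and> session C (env_queries \<tau>) = I \<and> env_queries \<tau> = q (fst (run p R))"
    if R: "ends net C E Y R rE rY" for R
  proof -
    obtain \<tau> s where \<tau>: "real_exec net C E Y R rE rY = (\<tau>, Some s)" "admissible net \<tau>"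
      "s = fst (run (session C (queries \<tau>)) R)"
      using real_exec_final[OF net R[unfolded C_def]] unfolding C_def by metis
    have p: "session C (queries \<tau>) = p" and I: "session C (env_queries \<tau>) = I"
      using real_exec_coupling(1,2)[OF net R[unfolded C_def] R0[unfolded C_def]] \<tau>(1) exec0(1)
      unfolding C_def p_def I_def by blast+
    have "\<exists>q. \<exists>R \<tau>. ends net C E Y R rE rY \<and> real_exec net C E Y R rE rY = (\<tau>, Some s) \<and> q = env_queries \<tau>"
      using R \<tau>(1) by blast
    from someI_ex[OF this, folded q_def] obtain R' \<tau>'
      where "ends net C E Y R' rE rY" "real_exec net C E Y R' rE rY = (\<tau>', Some s)" "q s = env_queries \<tau>'"
      by blast
    then have "env_queries \<tau> = q s"
      using real_exec_coupling(3)[OF net R[unfolded C_def], of R' \<tau> s \<tau>' s] \<tau>(1) unfolding C_def by simp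
    then show ?thesis using \<tau> p I by auto
  qed
  have "indist \<epsilon> \<delta> (law p) (law I)"
    unfolding p_def I_def C_def env_queries_admissible(1)[OF net exec0(2)]
    using exec0(3) env_queries_admissible(4)[OF net exec0(2)]
    by (intro session_indist[OF dict hi dp]) blast+
  moreover have "depth p \<le> coin_bound C (q s) \<and> depth I \<le> coin_bound C (q s)" if s: "s \<in> set_rand p" for s
  proof -
    \<comment> \<open>Executions end only for almost every tape, but each outcome of
      \<open>p\<close> has positive probability, so some ending execution attains it.\<close>
    obtain R where R: "ends net C E Y R rE rY" "fst (run p R) = s"
    proof (rule ccontr)
      assume "\<not> thesis"
      then have "\<forall>R. ends net C E Y R rE rY \<longrightarrow> fst (run p R) \<noteq> s" using that by blast
      then have ne: "AE R in coins. fst (run p R) \<noteq> s" using always by (auto elim!: eventually_mono)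
      have "{R \<in> space coins. \<not> fst (run p R) \<noteq> s} \<in> sets coins" by measurable
      then have "emeasure coins {R \<in> space coins. \<not> fst (run p R) \<noteq> s} = 0"
        using ne by (simp only: AE_iff_measurable[OF _ refl])
      then have "pmf (pmf_of_rand p) s = 0"
        using measure_run_eq[of p s] by (simp add: measure_def)
      then show False using s by (simp add: pmf_eq_0_set_pmf set_pmf_of_rand)
    qed
    from exec[OF R(1), unfolded R(2)] obtain \<tau> where \<tau>: "admissible net \<tau>"
      "session C (queries \<tau>) = p" "session C (env_queries \<tau>) = I" "env_queries \<tau> = q s"
      by blast
    note adm = env_queries_admissible[OF net \<tau>(1)]
    \<comment> \<open>Removing the subject's queries leaves \<open>q s\<close>, so its bound covers
      \<open>p\<close>; it also covers \<open>I\<close>, as the case in which the subject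
      interleaves nothing.\<close>
    have "depth p \<le> coin_bound C (q s)"
      using depth_le_coin_bound[OF bounded adm(4)] \<tau> unfolding adm(1)[symmetric] C_def by simp
    moreover have "subj_cid net \<notin> fst ` set (env_queries \<tau>)"
      using adm(2) net by (auto simp: network_ok_def)
    then have "filter (\<lambda>(c, m). c \<noteq> subj_cid net) (env_queries \<tau>) = env_queries \<tau>"
      "(subj_cid net, Tick) \<notin> set (env_queries \<tau>)"
      by (force simp: filter_id_conv)+
    then have "depth I \<le> coin_bound C (q s)"
      using depth_le_coin_bound[OF bounded, of "subj_cid net" "env_queries \<tau>"] \<tau> unfolding C_def by simp
    ultimately show ?thesis by blast
  qed
  moreover have "AE R in coins. \<forall>r. sim_tape net C E Y R rE rY r =
      resimulate (\<lambda>R. fst (run p R)) I (\<lambda>s. coin_bound C (q s)) R r"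
    using always
  proof eventually_elim
    case (elim R)
    from exec[OF this] show ?case
      by (auto simp: sim_tape_def conditional_sim_def resimulate_def Let_def)
  qed
  moreover have "AE R in coins. \<forall>r. fst (run I (sim_tape net C E Y R rE rY r)) = fst (run p R) \<longrightarrow> faithful net C E Y R rE rY r"
    using always
  proof eventually_elim
    case (elim R)
    from exec[OF this] obtain \<tau> where \<tau>: "real_exec net C E Y R rE rY = (\<tau>, Some (fst (run p R)))"
      "admissible net \<tau>" "session C (env_queries \<tau>) = I"
      by blast
    have "ideal_exec net C (env_queries \<tau>) R' = Some (fst (run I R'))" for R'
      using ideal_exec_dpml[OF env_queries_admissible(2)[OF net \<tau>(2)], of d M] \<tau>(3) unfolding C_def by simp
    then show ?case using \<tau>(1) by (simp add: faithful_def)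
  qed
  ultimately show ?thesis by (rule that)
qed

lemma sim_tape_indist:
  assumes "(AE R in coins. ends net C E Y R rE rY) \<or> (AE R in coins. \<not> ends net C E Y R rE rY)"
  shows "A \<in> sets coins \<Longrightarrow> (\<integral>\<^sup>+r. \<integral>\<^sup>+R. indicator A (sim_tape net C E Y R rE rY r) \<partial>coins \<partial>coins)
      \<le> ennreal (exp \<epsilon>) * emeasure coins A + ennreal \<delta>"
    and "A \<in> sets coins \<Longrightarrow> emeasure coins A \<le>
      ennreal (exp \<epsilon>) * (\<integral>\<^sup>+r. \<integral>\<^sup>+R. indicator A (sim_tape net C E Y R rE rY r) \<partial>coins \<partial>coins) + ennreal \<delta>"
    and "ennreal (1 - \<delta>) \<le> (\<integral>\<^sup>+r. \<integral>\<^sup>+R. indicator {R. faithful net C E Y R rE rY r} R \<partial>coins \<partial>coins)"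
proof -
  obtain p I :: "('p, 'o) dpml_state rand" and N
    where "indist \<epsilon> \<delta> (law p) (law I)" "\<And>s. s \<in> set_rand p \<Longrightarrow> depth p \<le> N s \<and> depth I \<le> N s"
      and eq: "AE R in coins. \<forall>r. sim_tape net C E Y R rE rY r = resimulate (\<lambda>R. fst (run p R)) I N R r"
      and faithful: "AE R in coins. \<forall>r. fst (run I (sim_tape net C E Y R rE rY r)) = fst (run p R) \<longrightarrow> faithful net C E Y R rE rY r"
    by (rule sim_tape_eq_resimulate[OF assms], rule that)
  note res = resimulate_indist[OF this(1,2)]
  have eqA: "(\<integral>\<^sup>+r. \<integral>\<^sup>+R. indicator A (sim_tape net C E Y R rE rY r) \<partial>coins \<partial>coins) =
      (\<integral>\<^sup>+r. \<integral>\<^sup>+R. indicator A (resimulate (\<lambda>R. fst (run p R)) I N R r) \<partial>coins \<partial>coins)" for A :: "bool stream set"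
    by (intro nn_integral_cong nn_integral_cong_AE) (use eq in \<open>auto elim!: eventually_mono\<close>)
  show "A \<in> sets coins \<Longrightarrow> (\<integral>\<^sup>+r. \<integral>\<^sup>+R. indicator A (sim_tape net C E Y R rE rY r) \<partial>coins \<partial>coins)
      \<le> ennreal (exp \<epsilon>) * emeasure coins A + ennreal \<delta>"
    unfolding eqA by (rule res(1))
  show "A \<in> sets coins \<Longrightarrow> emeasure coins A \<le>
      ennreal (exp \<epsilon>) * (\<integral>\<^sup>+r. \<integral>\<^sup>+R. indicator A (sim_tape net C E Y R rE rY r) \<partial>coins \<partial>coins) + ennreal \<delta>"
    unfolding eqA by (rule res(2))
  note res(3)
  also have "(\<integral>\<^sup>+r. \<integral>\<^sup>+R. indicator {s. fst (run I (resimulate (\<lambda>R. fst (run p R)) I N R r)) = s} (fst (run p R)) \<partial>coins \<partial>coins)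
      \<le> (\<integral>\<^sup>+r. \<integral>\<^sup>+R. indicator {R. faithful net C E Y R rE rY r} R \<partial>coins \<partial>coins)"
  proof (rule nn_integral_mono, rule nn_integral_mono_AE)
    fix r
    show "AE R in coins. indicator {s. fst (run I (resimulate (\<lambda>R. fst (run p R)) I N R r)) = s} (fst (run p R))
        \<le> (indicator {R. faithful net C E Y R rE rY r} R :: ennreal)"
      using eq faithful by eventually_elim (auto split: split_indicator)
  qed
  finally show "ennreal (1 - \<delta>) \<le> (\<integral>\<^sup>+r. \<integral>\<^sup>+R. indicator {R. faithful net C E Y R rE rY r} R \<partial>coins \<partial>coins)" .
qed

end

section \<open>Averaging over the remaining tapes\<close>

lemma (in prob_space) nn_integral_le_const_AE:
  assumes "AE x in M. f x \<le> c"
  shows "(\<integral>\<^sup>+x. f x \<partial>M) \<le> c"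
  using nn_integral_mono_AE[OF assms] by (simp add: emeasure_space_1)

text \<open>The lower bounds are affine in the simulated probability, and averaging over a
  probability space commutes with affine maps.\<close>

lemma (in prob_space) affine_nn_integral_ge_AE:
  assumes "AE x in M. c \<le> a * f x + b" and [measurable]: "f \<in> borel_measurable M"
  shows "c \<le> a * (\<integral>\<^sup>+x. f x \<partial>M) + b"
  using nn_integral_mono_AE[OF assms(1)]
  by (simp add: emeasure_space_1 nn_integral_add nn_integral_cmult)

text \<open>This order of integration puts the controller's and the simulator's tapes innermost,
  matching the bounds obtained for fixed tapes of the environment and the subject.\<close>

lemma nn_integral_coins_product:
  assumes [measurable]: "f \<in> borel_measurable (coins \<Otimes>\<^sub>M coins \<Otimes>\<^sub>M coins \<Otimes>\<^sub>M coins)"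
  shows "(\<integral>\<^sup>+\<omega>. f \<omega> \<partial>(coins \<Otimes>\<^sub>M coins \<Otimes>\<^sub>M coins \<Otimes>\<^sub>M coins)) =
    (\<integral>\<^sup>+rE. \<integral>\<^sup>+rY. \<integral>\<^sup>+r. \<integral>\<^sup>+R. f (R, rE, rY, r) \<partial>coins \<partial>coins \<partial>coins \<partial>coins)"
proof -
  interpret c2: pair_prob_space coins coins ..
  interpret c3: pair_prob_space coins "coins \<Otimes>\<^sub>M coins" ..
  interpret c4: pair_prob_space coins "coins \<Otimes>\<^sub>M coins \<Otimes>\<^sub>M coins" ..
  have "(\<integral>\<^sup>+\<omega>. f \<omega> \<partial>(coins \<Otimes>\<^sub>M coins \<Otimes>\<^sub>M coins \<Otimes>\<^sub>M coins)) =
      (\<integral>\<^sup>+z. \<integral>\<^sup>+R. f (R, z) \<partial>coins \<partial>(coins \<Otimes>\<^sub>M coins \<Otimes>\<^sub>M coins))"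
    by (rule c4.nn_integral_snd[symmetric]) measurable
  also have "\<dots> = (\<integral>\<^sup>+rE. \<integral>\<^sup>+y. \<integral>\<^sup>+R. f (R, rE, y) \<partial>coins \<partial>(coins \<Otimes>\<^sub>M coins) \<partial>coins)"
    by (subst c2.nn_integral_fst[symmetric]) simp_all
  also have "\<dots> = (\<integral>\<^sup>+rE. \<integral>\<^sup>+rY. \<integral>\<^sup>+r. \<integral>\<^sup>+R. f (R, rE, rY, r) \<partial>coins \<partial>coins \<partial>coins \<partial>coins)"
    by (intro nn_integral_cong, subst coins.nn_integral_fst[symmetric]) simp_all
  finally show ?thesis .
qed

theorem corollary5p2:
  fixes d :: "('p::countable, 'x::countable) dictionary"
    and M :: "'x dataset \<Rightarrow> ('o::countable) rand"
    and \<epsilon> \<delta> :: real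
  assumes "is_dictionary d" and "strongly_history_independent d"
    and "differentially_private \<epsilon> \<delta> M"
    and "coin_bounded (dpml_controller d M)"
  shows "deletion_as_control_against (ending_oblivious (dpml_controller d M)) \<epsilon> \<delta>
           (dpml_controller d M)"
proof -
  let ?C = "dpml_controller d M"
  let ?\<Omega> = "coins \<Otimes>\<^sub>M coins \<Otimes>\<^sub>M coins \<Otimes>\<^sub>M coins"
  \<comment> \<open>The empty event then gives \<open>0 \<le> \<delta>\<close>, which is needed to
    pass between \<open>ennreal\<close> and real bounds.\<close>
  have "indist \<epsilon> \<delta> (law (M fmempty)) (law (M fmempty))"
    using assms(3) by (simp add: differentially_private_def neighbors_def)
  then have \<delta>: "0 \<le> \<delta>"
    unfolding law_eq_measure_pmf indist_pmf_iff by (auto dest: spec[of _ "{}"])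
  have main: "indist \<epsilon> \<delta> (distr ?\<Omega> coins (\<lambda>(R, rE, rY, r). sim_tape net ?C E Y R rE rY r)) coins \<and>
      1 - \<delta> \<le> measure ?\<Omega> {\<omega> \<in> space ?\<Omega>. case \<omega> of (R, rE, rY, r) \<Rightarrow> faithful net ?C E Y R rE rY r}"
    if net: "network_ok net" and adv: "(net, E, Y) \<in> ending_oblivious ?C"
    for net and E Y :: "('x, 'o) outside_party"
  proof -
    interpret c2: pair_prob_space coins coins ..
    interpret c3: pair_prob_space coins "coins \<Otimes>\<^sub>M coins" ..
    interpret c4: pair_prob_space coins "coins \<Otimes>\<^sub>M coins \<Otimes>\<^sub>M coins" ..
    let ?S = "sim_tape net ?C E Y"
    let ?G = "faithful net ?C E Y"
    note [measurable (raw)] = measurable_faithful[OF net]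
    \<comment> \<open>The exceptional set of the product becomes exceptional sets of single tapes,
      to be discarded one integral at a time.\<close>
    have ae: "AE rE in coins. AE rY in coins.
        (AE R in coins. ends net ?C E Y R rE rY) \<or> (AE R in coins. \<not> ends net ?C E Y R rE rY)"
      using adv c2.AE_pair unfolding ending_oblivious_def by fastforce
    note bounds = sim_tape_indist[OF assms net]
    have S: "(\<lambda>(R, rE, rY, r). ?S R rE rY r) \<in> ?\<Omega> \<rightarrow>\<^sub>M coins" by measurable
    interpret D: prob_space "distr ?\<Omega> coins (\<lambda>(R, rE, rY, r). ?S R rE rY r)"
      by (rule c4.prob_space_distr[OF S])
    let ?D = "distr ?\<Omega> coins (\<lambda>(R, rE, rY, r). ?S R rE rY r)"
    have D: "emeasure ?D A =
        (\<integral>\<^sup>+rE. \<integral>\<^sup>+rY. \<integral>\<^sup>+r. \<integral>\<^sup>+R. indicator A (?S R rE rY r) \<partial>coins \<partial>coins \<partial>coins \<partial>coins)"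
      if [measurable]: "A \<in> sets coins" for A
    proof -
      have "emeasure ?D A = (\<integral>\<^sup>+R. indicator A R \<partial>?D)" by simp
      also have "\<dots> = (\<integral>\<^sup>+\<omega>. indicator A ((\<lambda>(R, rE, rY, r). ?S R rE rY r) \<omega>) \<partial>?\<Omega>)"
        using S by (rule nn_integral_distr) simp
      finally show ?thesis by (simp add: nn_integral_coins_product)
    qed
    have up: "emeasure ?D A \<le> ennreal (exp \<epsilon>) * emeasure coins A + ennreal \<delta>" if A: "A \<in> sets coins" for A
      unfolding D[OF A] using ae
      by (intro coins.nn_integral_le_const_AE)
        (auto elim!: eventually_mono intro!: coins.nn_integral_le_const_AE bounds(1)[OF _ A])
    have lo: "emeasure coins A \<le> ennreal (exp \<epsilon>) * emeasure ?D A + ennreal \<delta>"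
      if A [measurable]: "A \<in> sets coins" for A
    proof -
      have "AE rE in coins. emeasure coins A \<le> ennreal (exp \<epsilon>) *
          (\<integral>\<^sup>+rY. \<integral>\<^sup>+r. \<integral>\<^sup>+R. indicator A (?S R rE rY r) \<partial>coins \<partial>coins \<partial>coins) + ennreal \<delta>"
        using ae
      proof eventually_elim
        case (elim rE)
        then have "AE rY in coins. emeasure coins A \<le> ennreal (exp \<epsilon>) *
            (\<integral>\<^sup>+r. \<integral>\<^sup>+R. indicator A (?S R rE rY r) \<partial>coins \<partial>coins) + ennreal \<delta>"
          by eventually_elim (rule bounds(2)[OF _ A])
        then show ?case by (rule coins.affine_nn_integral_ge_AE) measurable
      qed
      then show ?thesis unfolding D[OF A] by (rule coins.affine_nn_integral_ge_AE) measurable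
    qed
    have "indist \<epsilon> \<delta> ?D coins"
      unfolding indist_def
    proof (intro conjI ballI)
      fix A assume "A \<in> sets ?D"
      then have A: "A \<in> sets coins" by simp
      show "measure ?D A \<le> exp \<epsilon> * measure coins A + \<delta>"
        using up[OF A] \<delta> by (simp add: D.emeasure_eq_measure coins.emeasure_eq_measure
            flip: ennreal_mult ennreal_plus)
      show "measure coins A \<le> exp \<epsilon> * measure ?D A + \<delta>"
        using lo[OF A] \<delta> by (simp add: D.emeasure_eq_measure coins.emeasure_eq_measure
            flip: ennreal_mult ennreal_plus)
    qed simp
    moreover have "1 - \<delta> \<le> measure ?\<Omega> {\<omega> \<in> space ?\<Omega>. case \<omega> of (R, rE, rY, r) \<Rightarrow> ?G R rE rY r}"
    proof -
      let ?B = "{\<omega> \<in> space ?\<Omega>. case \<omega> of (R, rE, rY, r) \<Rightarrow> ?G R rE rY r}"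
      have [measurable]: "?B \<in> sets ?\<Omega>" unfolding case_prod_beta by measurable
      \<comment> \<open>The factor 1 and the summand 0 cast the bound into the form of
        \<open>affine_nn_integral_ge_AE\<close>.\<close>
      have "AE rE in coins. ennreal (1 - \<delta>) \<le> 1 *
          (\<integral>\<^sup>+rY. \<integral>\<^sup>+r. \<integral>\<^sup>+R. indicator {R. ?G R rE rY r} R \<partial>coins \<partial>coins \<partial>coins) + 0"
        using ae
      proof eventually_elim
        case (elim rE)
        then have "AE rY in coins. ennreal (1 - \<delta>) \<le> 1 *
            (\<integral>\<^sup>+r. \<integral>\<^sup>+R. indicator {R. ?G R rE rY r} R \<partial>coins \<partial>coins) + 0"
          using bounds(3) by (auto elim!: eventually_mono)
        then show ?case by (rule coins.affine_nn_integral_ge_AE) measurable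
      qed
      then have "ennreal (1 - \<delta>) \<le> 1 *
          (\<integral>\<^sup>+rE. \<integral>\<^sup>+rY. \<integral>\<^sup>+r. \<integral>\<^sup>+R. indicator {R. ?G R rE rY r} R \<partial>coins \<partial>coins \<partial>coins \<partial>coins) + 0"
        by (rule coins.affine_nn_integral_ge_AE) measurable
      also have "\<dots> = (\<integral>\<^sup>+\<omega>. indicator ?B \<omega> \<partial>?\<Omega>)"
        unfolding add_0_right mult_1
        by (subst nn_integral_coins_product, measurable)
          (intro nn_integral_cong, simp add: space_pair_measure split: split_indicator)
      also have "\<dots> = ennreal (measure ?\<Omega> ?B)" by (simp add: c4.emeasure_eq_measure)
      finally show ?thesis by simp
    qed
    ultimately show ?thesis by blast
  qed
  show ?thesis
    unfolding deletion_as_control_against_def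
  proof (intro exI[of _ "conditional_sim ?C"] conjI allI impI)
    show "(\<lambda>(R, r). conditional_sim ?C q R s r) \<in> coins \<Otimes>\<^sub>M coins \<rightarrow>\<^sub>M count_space UNIV" for q s
      unfolding case_prod_beta by (intro measurable_conditional_sim) measurable
  next
    fix net and E Y :: "('x, 'o) outside_party"
    assume "network_ok net" "(net, E, Y) \<in> ending_oblivious ?C"
    from main[OF this] show "let \<Omega> = ?\<Omega>;
          q_E = (\<lambda>(R, rE, rY, r). env_queries (fst (real_exec net ?C E Y R rE rY)));
          state = (\<lambda>(R, rE, rY, r). snd (real_exec net ?C E Y R rE rY));
          R' = (\<lambda>(R, rE, rY, r). overwrite
            (conditional_sim ?C (q_E (R, rE, rY, r)) R (state (R, rE, rY, r)) r) R);
          state' = (\<lambda>\<omega>. ideal_exec net ?C (q_E \<omega>) (R' \<omega>))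
        in indist \<epsilon> \<delta> (distr \<Omega> coins R') coins \<and>
           1 - \<delta> \<le> measure \<Omega> {\<omega> \<in> space \<Omega>. state' \<omega> = state \<omega> \<or> state \<omega> = None}"
      unfolding Let_def sim_tape_def faithful_def
      by (simp add: case_prod_beta)
  qed
qed

end
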